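(* Let $K$ be a field with at least $4$ elements and let $S$ be a smooth cubic surface over $K$. Suppose $S$ contains a skew pair of lines $\ell,\ell'$, both defined over $K$. Let $P$ be any $K$-rational point on $\ell$ or on $\ell'$ that is not an Eckardt point. Then $\mathrm{Span}(P)=S(K)$.
   Context: A smooth cubic surface $S$ over $K$ is a nonsingular surface in $\mathbb{P}^3$ defined by a homogeneous cubic polynomial $F\in K[x_0,x_1,x_2,x_3]$. A $K$-line is a line in $\mathbb{P}^3$ defined over $K$. A line "on $S$" means a line over $\overline{K}$ contained in $S$ (there are 27 of them). A skew pair of lines is a pair of disjoint lines. An Eckardt point is a point of $S$ through which three of the lines on $S$ pass. Secant and tangent process: if $\ell$ is a line not contained in $S$, then $\ell\cdot S=P+Q+R$ (points counted with multiplicity). For $B\subseteq S(K)$ define $B_0=B$ and $B_{n+1}$ as the set of $R\in S(K)$ such that either $R\in B_n$ or there exist $P,Q\in B_n$ and a $K$-line $\ell\not\subset S$ with $\ell\cdot S=P+Q+R$. Then $\mathrm{Span}(B)=\bigcup_{n\ge0}B_n$, and $\mathrm{Span}(P)=\mathrm{Span}(\{P\})$. *)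

theory Defs
  imports "HOL-Analysis.Finite_Cartesian_Product" "HOL-Algebra.Algebraic_Closure_Type"
begin

text \<open>Homogeneous coordinates in P^3 over a field: vectors in 'b^4.
  A cubic form F is given by its coefficient function on the monomials
  x0^m0 x1^m1 x2^m2 x3^m3 with m0+m1+m2+m3 = 3.\<close>


definition mons3 :: "(4 \<Rightarrow> nat) set" where
  "mons3 = {m. (\<Sum>i\<in>UNIV. m i) = 3}"

definition cubic_eval :: "((4 \<Rightarrow> nat) \<Rightarrow> 'b::field) \<Rightarrow> 'b^4 \<Rightarrow> 'b" where
  "cubic_eval c x = (\<Sum>m\<in>mons3. c m * (\<Prod>i\<in>UNIV. (x$i) ^ (m i)))"

definition cubic_partial :: "((4 \<Rightarrow> nat) \<Rightarrow> 'b::field) \<Rightarrow> 4 \<Rightarrow> 'b^4 \<Rightarrow> 'b" where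
  "cubic_partial c j x = (\<Sum>m\<in>mons3. c m * of_nat (m j) *
      (\<Prod>i\<in>UNIV. (x$i) ^ (if i = j then m i - 1 else m i)))"

definition to_ac_vec :: "'a::field ^4 \<Rightarrow> 'a alg_closure ^4" where
  "to_ac_vec u = (\<chi> i. to_ac (u$i))"

definition smooth_cubic :: "((4 \<Rightarrow> nat) \<Rightarrow> 'a::field) \<Rightarrow> bool" where
  "smooth_cubic c \<longleftrightarrow> (\<exists>m\<in>mons3. c m \<noteq> 0) \<and>
     (\<forall>x :: 'a alg_closure ^4. x \<noteq> 0 \<longrightarrow>
        \<not> (cubic_eval (to_ac \<circ> c) x = 0 \<and> (\<forall>j. cubic_partial (to_ac \<circ> c) j x = 0)))"

definition proj_pt :: "'b::field ^4 \<Rightarrow> ('b^4) set" where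
  "proj_pt v = {a *s v | a. a \<noteq> 0}"

definition surf_pts :: "((4 \<Rightarrow> nat) \<Rightarrow> 'b::field) \<Rightarrow> ('b^4) set set" where
  "surf_pts c = {proj_pt x | x. x \<noteq> 0 \<and> cubic_eval c x = 0}"

definition lin_indep2 :: "'b::field ^4 \<Rightarrow> 'b^4 \<Rightarrow> bool" where
  "lin_indep2 u v \<longleftrightarrow> (\<forall>a b. a *s u + b *s v = 0 \<longrightarrow> a = 0 \<and> b = 0)"

definition line_through :: "'b::field ^4 \<Rightarrow> 'b^4 \<Rightarrow> ('b^4) set set" where
  "line_through u v = {proj_pt (a *s u + b *s v) | a b. a \<noteq> 0 \<or> b \<noteq> 0}"

definition is_line :: "('b::field ^4) set set \<Rightarrow> bool" where
  "is_line L \<longleftrightarrow> (\<exists>u v. lin_indep2 u v \<and> L = line_through u v)"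

definition line_on_surf :: "((4 \<Rightarrow> nat) \<Rightarrow> 'a::field) \<Rightarrow> ('a alg_closure ^4) set set \<Rightarrow> bool" where
  "line_on_surf c L \<longleftrightarrow> is_line L \<and> L \<subseteq> surf_pts (to_ac \<circ> c)"

definition K_line :: "('a::field alg_closure ^4) set set \<Rightarrow> bool" where
  "K_line L \<longleftrightarrow> (\<exists>u v :: 'a^4. lin_indep2 u v \<and> L = line_through (to_ac_vec u) (to_ac_vec v))"

definition eckardt :: "((4 \<Rightarrow> nat) \<Rightarrow> 'a::field) \<Rightarrow> ('a alg_closure ^4) set \<Rightarrow> bool" where
  "eckardt c P \<longleftrightarrow> P \<in> surf_pts (to_ac \<circ> c) \<and>
     (\<exists>L1 L2 L3. line_on_surf c L1 \<and> line_on_surf c L2 \<and> line_on_surf c L3 \<and>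
        L1 \<noteq> L2 \<and> L1 \<noteq> L3 \<and> L2 \<noteq> L3 \<and> P \<in> L1 \<and> P \<in> L2 \<and> P \<in> L3)"

text \<open>Restriction of F to the line through u, v: the polynomial in t equal to
  F(u + t v); this is the dehomogenisation (s = 1) of the binary cubic form
  g(s,t) = F(s u + t v).\<close>
definition line_poly :: "((4 \<Rightarrow> nat) \<Rightarrow> 'b::field) \<Rightarrow> 'b^4 \<Rightarrow> 'b^4 \<Rightarrow> 'b poly" where
  "line_poly c u v = (\<Sum>m\<in>mons3. smult (c m) (\<Prod>i\<in>UNIV. [:u$i, v$i:] ^ (m i)))"

text \<open>Secant and tangent process over K: there is a K-line l (spanned by the
  K-vectors u, v), not contained in S, with l.S = P + Q + R, i.e. the binary
  cubic g(s,t) = F(s u + t v) is a nonzero multiple of the product of the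
  linear forms b s - a t vanishing at the points a u + b v representing P, Q, R.\<close>
definition sec_tan :: "((4 \<Rightarrow> nat) \<Rightarrow> 'a::field) \<Rightarrow> ('a^4) set \<Rightarrow> ('a^4) set \<Rightarrow> ('a^4) set \<Rightarrow> bool" where
  "sec_tan c P Q R \<longleftrightarrow> (\<exists>u v a1 b1 a2 b2 a3 b3 k.
     lin_indep2 u v \<and> k \<noteq> 0 \<and>
     (a1 \<noteq> 0 \<or> b1 \<noteq> 0) \<and> (a2 \<noteq> 0 \<or> b2 \<noteq> 0) \<and> (a3 \<noteq> 0 \<or> b3 \<noteq> 0) \<and>
     P = proj_pt (a1 *s u + b1 *s v) \<and> Q = proj_pt (a2 *s u + b2 *s v) \<and>
     R = proj_pt (a3 *s u + b3 *s v) \<and>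
     line_poly c u v = smult k ([:b1, -a1:] * [:b2, -a2:] * [:b3, -a3:]))"

definition span_step :: "((4 \<Rightarrow> nat) \<Rightarrow> 'a::field) \<Rightarrow> ('a^4) set set \<Rightarrow> ('a^4) set set" where
  "span_step c B = B \<union> {R \<in> surf_pts c. \<exists>P\<in>B. \<exists>Q\<in>B. sec_tan c P Q R}"

definition Span :: "((4 \<Rightarrow> nat) \<Rightarrow> 'a::field) \<Rightarrow> ('a^4) set set \<Rightarrow> ('a^4) set set" where
  "Span c B = (\<Union>n. (span_step c ^^ n) B)"

end

(*
  Let l, l' be the skew lines and let P on l be a point whose tangent plane section is l + C with C
  a conic that is smooth at P. The lines through P in this plane put all points of C, except possibly
  the second point P' of C on l, into the span; lines through two points of C then give l except P'.
  If P' differs from P, the Gauss map of l is separable of degree two, so with at least four field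
  elements some tangent plane other than that at P touches l in two distinct rational points, and
  this plane yields P'. If C splits into two lines, apply the same argument to the component of C
  that does not pass through P.

  Points of l' are reached as tangency residues: the tangent plane at P meets l' in a point Y, and the
  line P Y is tangent at P. If Y is not an Eckardt point, repeat the argument on l'; otherwise a second
  point of l' obtained in the same way, together with a transversal line through Y, fills up l'.

  Finally a point R lies on a unique transversal of l and l'. If that line is not in S, R is its third
  point. If it is, R is generated in the plane joining it to l or to l', unless R is singular.
*)
theory Submission
  imports Defs "HOL-Analysis.Cartesian_Space"
begin

section \<open>Cubic monomials as products of three variables\<close>

lemma prod_power_fun_upd:
  fixes f :: "4 \<Rightarrow> 'r::comm_monoid_mult"
  shows "(\<Prod>l\<in>UNIV. f l ^ (m(i := Suc (m i))) l) = f i * (\<Prod>l\<in>UNIV. f l ^ m l)"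
proof -
  have "(\<Prod>l\<in>UNIV. f l ^ (m(i := Suc (m i))) l)
      = f i ^ Suc (m i) * (\<Prod>l\<in>UNIV - {i}. f l ^ (m(i := Suc (m i))) l)"
    by (subst prod.remove[of UNIV i]) auto
  also have "(\<Prod>l\<in>UNIV - {i}. f l ^ (m(i := Suc (m i))) l) = (\<Prod>l\<in>UNIV - {i}. f l ^ m l)"
    by (rule prod.cong) auto
  also have "f i ^ Suc (m i) * \<dots> = f i * (\<Prod>l\<in>UNIV. f l ^ m l)"
    by (simp add: prod.remove[of UNIV i "\<lambda>l. f l ^ m l"] mult.assoc)
  finally show ?thesis .
qed

text \<open>The formal partial derivative of a monomial; at exponent 0 the leading factor vanishes,
  so the truncated subtraction is harmless.\<close>

definition mon_deriv :: "(4 \<Rightarrow> nat) \<Rightarrow> 4 \<Rightarrow> (4 \<Rightarrow> 'r::comm_semiring_1) \<Rightarrow> 'r" where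
  "mon_deriv m j f = of_nat (m j) * (\<Prod>l\<in>UNIV. f l ^ (if l = j then m l - 1 else m l))"

text \<open>The product rule for one variable times a monomial; with it derivatives are computed
  factor by factor.\<close>

lemma mon_deriv_fun_upd:
  fixes f :: "4 \<Rightarrow> 'r::comm_semiring_1"
  shows "mon_deriv (m(i := Suc (m i))) j f
    = (if i = j then (\<Prod>l\<in>UNIV. f l ^ m l) else 0) + f i * mon_deriv m j f"
proof -
  define m0 where "m0 l = (if l = j then m l - 1 else m l)" for l
  have deriv: "mon_deriv m j f = of_nat (m j) * (\<Prod>l\<in>UNIV. f l ^ m0 l)"
    by (simp add: mon_deriv_def m0_def)
  show ?thesis
  proof (cases "i = j")
    case False
    have "(\<Prod>l\<in>UNIV. f l ^ (if l = j then (m(i := Suc (m i))) l - 1 else (m(i := Suc (m i))) l))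
        = (\<Prod>l\<in>UNIV. f l ^ (m0(i := Suc (m0 i))) l)"
      using False by (intro prod.cong) (auto simp: m0_def)
    then have "mon_deriv (m(i := Suc (m i))) j f = of_nat (m j) * (f i * (\<Prod>l\<in>UNIV. f l ^ m0 l))"
      using False unfolding mon_deriv_def prod_power_fun_upd by simp
    then show ?thesis using False by (simp add: deriv mult.left_commute)
  next
    case True
    have "(\<Prod>l\<in>UNIV. f l ^ (if l = j then (m(i := Suc (m i))) l - 1 else (m(i := Suc (m i))) l))
        = (\<Prod>l\<in>UNIV. f l ^ m l)"
      using True by (intro prod.cong) auto
    then have lhs: "mon_deriv (m(i := Suc (m i))) j f
        = (1 + of_nat (m j)) * (\<Prod>l\<in>UNIV. f l ^ m l)"
      using True unfolding mon_deriv_def by simp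
    have "of_nat (m j) * (\<Prod>l\<in>UNIV. f l ^ m l) = f j * mon_deriv m j f"
    proof (cases "m j")
      case (Suc n)
      have "(\<Prod>l\<in>UNIV. f l ^ m l) = (\<Prod>l\<in>UNIV. f l ^ (m0(j := Suc (m0 j))) l)"
        using Suc by (intro prod.cong) (auto simp: m0_def)
      then show ?thesis unfolding deriv prod_power_fun_upd by (simp add: mult.left_commute)
    qed (simp add: deriv)
    then show ?thesis using True lhs by (simp add: distrib_right)
  qed
qed

lemma sum_Suc_fun_upd:
  fixes m :: "4 \<Rightarrow> nat"
  assumes "sum m UNIV = Suc n"
  obtains i m' where "m = m'(i := Suc (m' i))" "sum m' UNIV = n"
proof -
  obtain i where i: "m i \<noteq> 0"
    using assms by (metis Zero_not_Suc sum.neutral)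
  define m' where "m' = m(i := m i - 1)"
  have m: "m = m'(i := Suc (m' i))" using i by (auto simp: m'_def)
  have "sum m UNIV = m i + sum m (UNIV - {i})" by (simp add: sum.remove[of UNIV i])
  moreover have "sum m' UNIV = m' i + sum m' (UNIV - {i})" by (simp add: sum.remove[of UNIV i])
  moreover have "sum m' (UNIV - {i}) = sum m (UNIV - {i})"
    by (rule sum.cong) (auto simp: m'_def)
  ultimately have "sum m' UNIV = n" using assms i by (simp add: m'_def)
  then show thesis using m that by blast
qed

definition mon3 :: "4 \<times> 4 \<times> 4 \<Rightarrow> 4 \<Rightarrow> nat" where
  "mon3 = (\<lambda>(i, j, k) l. of_bool (l = i) + of_bool (l = j) + of_bool (l = k))"

lemma mon3_fun_upd:
  "mon3 (i, j, k) = (let m1 = (\<lambda>_. 0)(i := Suc 0); m2 = m1(j := Suc (m1 j)) in m2(k := Suc (m2 k)))"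
  by (auto simp: mon3_def Let_def fun_eq_iff)

lemma mons3_mon3:
  assumes "m \<in> mons3"
  shows "\<exists>t. m = mon3 t"
proof -
  have "sum m UNIV = Suc (Suc (Suc 0))" using assms by (simp add: mons3_def)
  then obtain i m1 where 1: "m = m1(i := Suc (m1 i))" "sum m1 UNIV = Suc (Suc 0)"
    by (rule sum_Suc_fun_upd)
  from 1(2) obtain j m2 where 2: "m1 = m2(j := Suc (m2 j))" "sum m2 UNIV = Suc 0"
    by (rule sum_Suc_fun_upd)
  from 2(2) obtain k m3 where 3: "m2 = m3(k := Suc (m3 k))" "sum m3 UNIV = 0"
    by (rule sum_Suc_fun_upd)
  have "m3 = (\<lambda>_. 0)" using 3(2) by auto
  then have "m = mon3 (k, j, i)"
    using 1(1) 2(1) 3(1) by (auto simp: mon3_def fun_eq_iff)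
  then show ?thesis by blast
qed

text \<open>An arbitrary ordering of the three factors. \<open>cubic_tri\<close> depends on it; the
  symmetrizations \<open>cubic_D\<close> and \<open>cubic_T\<close> do not.\<close>

definition mon_ix :: "(4 \<Rightarrow> nat) \<Rightarrow> 4 \<times> 4 \<times> 4" where
  "mon_ix m = (SOME t. m = mon3 t)"

lemma mon_ix: "m \<in> mons3 \<Longrightarrow> mon_ix m = (i, j, k) \<Longrightarrow> m = mon3 (i, j, k)"
  using someI_ex[OF mons3_mon3, of m] by (simp add: mon_ix_def)

lemma prod_mon3:
  fixes f :: "4 \<Rightarrow> 'r::comm_semiring_1"
  shows "(\<Prod>l\<in>UNIV. f l ^ mon3 (i, j, k) l) = f i * f j * f k"
  by (simp add: mon3_fun_upd Let_def prod_power_fun_upd del: fun_upd_apply)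
     (simp add: mult_ac prod_power_fun_upd[of f "\<lambda>_. 0", simplified])

lemma mon_deriv_mon3:
  fixes f :: "4 \<Rightarrow> 'r::comm_semiring_1"
  shows "mon_deriv (mon3 (i, j, k)) l f
    = (if i = l then f j * f k else 0) + (if j = l then f i * f k else 0)
      + (if k = l then f i * f j else 0)"
proof -
  have 0: "mon_deriv ((\<lambda>_. 0)(i := Suc 0)) l f = (if i = l then 1 else 0)"
    using mon_deriv_fun_upd[of "\<lambda>_. 0" i l f] by (simp add: mon_deriv_def)
  have 1: "(\<Prod>l\<in>UNIV. f l ^ ((\<lambda>_. 0)(i := Suc 0)) l) = f i"
    using prod_power_fun_upd[of f "\<lambda>_. 0" i] by simp
  show ?thesis
    by (simp add: mon3_fun_upd Let_def mon_deriv_fun_upd prod_power_fun_upd 0 1 del: fun_upd_apply)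
       (simp add: algebra_simps)
qed

section \<open>Polarization of a cubic form\<close>

text \<open>An (unsymmetrized) trilinear form whose diagonal is the cubic form; it makes the polarizations below
  meaningful in characteristics 2 and 3.\<close>
definition cubic_tri :: "((4 \<Rightarrow> nat) \<Rightarrow> 'b::field) \<Rightarrow> 'b^4 \<Rightarrow> 'b^4 \<Rightarrow> 'b^4 \<Rightarrow> 'b" where
  "cubic_tri c u v w = (\<Sum>m\<in>mons3. c m * (case mon_ix m of (i, j, k) \<Rightarrow> vec_nth u i * vec_nth v j * vec_nth w k))"

text \<open>The derivative of the form at \<open>u\<close> in direction \<open>v\<close>: at a
  smooth point \<open>u\<close> its zeros in \<open>v\<close> form the tangent plane.\<close>

definition cubic_D :: "((4 \<Rightarrow> nat) \<Rightarrow> 'b::field) \<Rightarrow> 'b^4 \<Rightarrow> 'b^4 \<Rightarrow> 'b" where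
  "cubic_D c u v = cubic_tri c u u v + cubic_tri c u v u + cubic_tri c v u u"

text \<open>The full polarization: the coefficient of r s t in the form at r u + s v + t w.\<close>

definition cubic_T :: "((4 \<Rightarrow> nat) \<Rightarrow> 'b::field) \<Rightarrow> 'b^4 \<Rightarrow> 'b^4 \<Rightarrow> 'b^4 \<Rightarrow> 'b" where
  "cubic_T c u v w = cubic_tri c u v w + cubic_tri c u w v + cubic_tri c v u w
     + cubic_tri c v w u + cubic_tri c w u v + cubic_tri c w v u"

lemma cubic_eval_tri: "cubic_eval c x = cubic_tri c x x x"
  unfolding cubic_eval_def cubic_tri_def
proof (rule sum.cong[OF refl])
  fix m :: "4 \<Rightarrow> nat" assume m: "m \<in> mons3"
  obtain i j k where t: "mon_ix m = (i, j, k)" by (cases "mon_ix m")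
  show "c m * (\<Prod>i\<in>UNIV. vec_nth x i ^ m i) = c m * (case mon_ix m of (i, j, k) \<Rightarrow> vec_nth x i * vec_nth x j * vec_nth x k)"
    unfolding prod_mon3[of _ i j k, folded mon_ix[OF m t]] by (simp add: t)
qed

lemma cubic_tri_add:
  "cubic_tri c (u + u') v w = cubic_tri c u v w + cubic_tri c u' v w"
  "cubic_tri c u (v + v') w = cubic_tri c u v w + cubic_tri c u v' w"
  "cubic_tri c u v (w + w') = cubic_tri c u v w + cubic_tri c u v w'"
  unfolding cubic_tri_def sum.distrib[symmetric]
  by (rule sum.cong; simp add: algebra_simps split: prod.split)+

lemma cubic_tri_scale:
  "cubic_tri c (a *s u) v w = a * cubic_tri c u v w"
  "cubic_tri c u (a *s v) w = a * cubic_tri c u v w"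
  "cubic_tri c u v (a *s w) = a * cubic_tri c u v w"
  unfolding cubic_tri_def sum_distrib_left
  by (rule sum.cong; simp add: algebra_simps split: prod.split)+

lemma cubic_F_add: "cubic_eval c (u + v) = cubic_eval c u + cubic_D c u v + cubic_D c v u + cubic_eval c v"
  and cubic_F_scale: "cubic_eval c (a *s u) = a^3 * cubic_eval c u"
  and cubic_D_add_left: "cubic_D c (u + v) w = cubic_D c u w + cubic_T c u v w + cubic_D c v w"
  and cubic_D_add_right: "cubic_D c u (v + w) = cubic_D c u v + cubic_D c u w"
  and cubic_D_scale_left: "cubic_D c (a *s u) v = a^2 * cubic_D c u v"
  and cubic_D_scale_right: "cubic_D c u (a *s v) = a * cubic_D c u v"
  and cubic_D_self: "cubic_D c u u = 3 * cubic_eval c u"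
  by (simp_all add: cubic_eval_tri cubic_D_def cubic_T_def cubic_tri_add cubic_tri_scale
      power2_eq_square power3_eq_cube algebra_simps)

lemma cubic_T_add:
  "cubic_T c (u + u') v w = cubic_T c u v w + cubic_T c u' v w"
  "cubic_T c u (v + v') w = cubic_T c u v w + cubic_T c u v' w"
  "cubic_T c u v (w + w') = cubic_T c u v w + cubic_T c u v w'"
  and cubic_T_scale:
  "cubic_T c (a *s u) v w = a * cubic_T c u v w"
  "cubic_T c u (a *s v) w = a * cubic_T c u v w"
  "cubic_T c u v (a *s w) = a * cubic_T c u v w"
  and cubic_T_self:
  "cubic_T c u u v = 2 * cubic_D c u v"
  "cubic_T c u v u = 2 * cubic_D c u v"
  "cubic_T c v u u = 2 * cubic_D c u v"
  and cubic_T_commute: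
  "cubic_T c u v w = cubic_T c v u w"
  "cubic_T c u v w = cubic_T c u w v"
  by (simp_all add: cubic_D_def cubic_T_def cubic_tri_add cubic_tri_scale algebra_simps)

lemma cubic_minus:
  "cubic_eval c (- u) = - cubic_eval c u"
  "cubic_D c (- u) v = cubic_D c u v"
  "cubic_D c u (- v) = - cubic_D c u v"
  "cubic_T c (- u) v w = - cubic_T c u v w"
  "cubic_T c u (- v) w = - cubic_T c u v w"
  "cubic_T c u v (- w) = - cubic_T c u v w"
  using cubic_F_scale[of c "-1" u] cubic_D_scale_left[of c "-1" u v]
    cubic_D_scale_right[of c u "-1" v] cubic_T_scale(1)[of c "-1" u v w]
    cubic_T_scale(2)[of c u "-1" v w] cubic_T_scale(3)[of c u v "-1" w]
  by (simp_all add: vector_smult_lneg)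

lemma cubic_diff:
  "cubic_eval c (u - v) = cubic_eval c u - cubic_D c u v + cubic_D c v u - cubic_eval c v"
  "cubic_D c (u - v) w = cubic_D c u w - cubic_T c u v w + cubic_D c v w"
  "cubic_D c u (v - w) = cubic_D c u v - cubic_D c u w"
  "cubic_T c (u - u') v w = cubic_T c u v w - cubic_T c u' v w"
  "cubic_T c u (v - v') w = cubic_T c u v w - cubic_T c u v' w"
  "cubic_T c u v (w - w') = cubic_T c u v w - cubic_T c u v w'"
  by (simp_all only: diff_conv_add_uminus cubic_F_add cubic_D_add_left cubic_D_add_right
      cubic_T_add cubic_minus)

lemmas cubic_simps = cubic_minus cubic_diff cubic_F_add cubic_F_scale cubic_D_add_left cubic_D_add_right
  cubic_D_scale_left cubic_D_scale_right cubic_D_self cubic_T_add cubic_T_scale cubic_T_self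

lemma cubic_partial_eq_D:
  fixes c :: "(4 \<Rightarrow> nat) \<Rightarrow> 'b::field"
  shows "cubic_partial c j x = cubic_D c x (axis j 1)"
proof -
  define e :: "'b^4" where "e = axis j 1"
  have "cubic_partial c j x = (\<Sum>m\<in>mons3. c m * mon_deriv m j (\<lambda>i. vec_nth x i))"
    by (simp add: cubic_partial_def mon_deriv_def mult.assoc)
  also have "\<dots> = (\<Sum>m\<in>mons3. c m * (case mon_ix m of (i, k, l) \<Rightarrow>
      vec_nth x i * vec_nth x k * vec_nth e l + vec_nth x i * vec_nth e k * vec_nth x l + vec_nth e i * vec_nth x k * vec_nth x l))"
  proof (rule sum.cong[OF refl])
    fix m :: "4 \<Rightarrow> nat" assume m: "m \<in> mons3"
    obtain i k l where t: "mon_ix m = (i, k, l)" by (cases "mon_ix m")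
    show "c m * mon_deriv m j (\<lambda>i. vec_nth x i) = c m * (case mon_ix m of (i, k, l) \<Rightarrow>
      vec_nth x i * vec_nth x k * vec_nth e l + vec_nth x i * vec_nth e k * vec_nth x l + vec_nth e i * vec_nth x k * vec_nth x l)"
      unfolding mon_deriv_mon3[of i k l, folded mon_ix[OF m t]] by (simp add: t e_def axis_def)
  qed
  also have "\<dots> = cubic_D c x e"
    unfolding cubic_D_def cubic_tri_def sum.distrib[symmetric]
    by (rule sum.cong) (simp_all add: case_prod_beta algebra_simps)
  finally show ?thesis by (simp only: e_def)
qed

lemma cubic_D_zero_right [simp]: "cubic_D c u 0 = 0"
  using cubic_D_scale_right[of c u 0 0] by simp

lemma cubic_D_eq_sum_partial: "cubic_D c x w = (\<Sum>j\<in>UNIV. vec_nth w j * cubic_partial c j x)"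
proof -
  have "cubic_D c x (\<Sum>j\<in>A. vec_nth w j *s axis j 1) = (\<Sum>j\<in>A. vec_nth w j * cubic_D c x (axis j 1))" for A
    by (induction A rule: infinite_finite_induct)
       (simp_all add: cubic_D_add_right cubic_D_scale_right)
  from this[of UNIV] show ?thesis by (simp add: basis_expansion cubic_partial_eq_D)
qed

lemma smooth_cubicD:
  assumes "smooth_cubic c" "x \<noteq> 0" "cubic_eval (to_ac \<circ> c) x = 0"
  shows "\<exists>w. cubic_D (to_ac \<circ> c) x w \<noteq> 0"
  using assms unfolding smooth_cubic_def by (metis cubic_partial_eq_D)

lemma pCons_sum:
  fixes g :: "_ \<Rightarrow> 'b::comm_monoid_add poly"
  shows "(\<Sum>m\<in>A. pCons (f m) (g m)) = pCons (sum f A) (sum g A)"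
  by (induction A rule: infinite_finite_induct) auto

text \<open>\<open>q\<close> expands a product of three linear polynomials. This turns intersection
  multiplicities on a line into conditions on \<open>cubic_D\<close>.\<close>

lemma line_poly_eq:
  "line_poly c u v = [:cubic_eval c u, cubic_D c u v, cubic_D c v u, cubic_eval c v:]"
proof -
  define q where "q = (\<lambda>(i, j, k). [: vec_nth u i * vec_nth u j * vec_nth u k,
        vec_nth u i * vec_nth u j * vec_nth v k + vec_nth u i * vec_nth v j * vec_nth u k + vec_nth v i * vec_nth u j * vec_nth u k,
        vec_nth v i * vec_nth v j * vec_nth u k + vec_nth v i * vec_nth u j * vec_nth v k + vec_nth u i * vec_nth v j * vec_nth v k,
        vec_nth v i * vec_nth v j * vec_nth v k:])"
  have "line_poly c u v = (\<Sum>m\<in>mons3. smult (c m) (q (mon_ix m)))"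
    unfolding line_poly_def
  proof (rule sum.cong[OF refl])
    fix m :: "4 \<Rightarrow> nat" assume m: "m \<in> mons3"
    obtain i j k where t: "mon_ix m = (i, j, k)" by (cases "mon_ix m")
    show "smult (c m) (\<Prod>i\<in>UNIV. [:vec_nth u i, vec_nth v i:] ^ m i) = smult (c m) (q (mon_ix m))"
      unfolding prod_mon3[of _ i j k, folded mon_ix[OF m t]] by (simp add: t q_def algebra_simps)
  qed
  also have "\<dots> = [:cubic_eval c u, cubic_D c u v, cubic_D c v u, cubic_eval c v:]"
    unfolding cubic_eval_tri cubic_D_def cubic_tri_def
    by (simp add: q_def case_prod_beta pCons_sum sum.distrib distrib_left add_ac)
  finally show ?thesis .
qed

section \<open>Passage to the algebraic closure\<close>

lemma to_ac_vec_add [simp]: "to_ac_vec (u + v) = to_ac_vec u + to_ac_vec v"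
  and to_ac_vec_scale [simp]: "to_ac_vec (a *s u) = to_ac a *s to_ac_vec u"
  and to_ac_vec_eq_0_iff [simp]: "to_ac_vec u = 0 \<longleftrightarrow> u = 0"
  by (auto simp: to_ac_vec_def vec_eq_iff)

lemma cubic_tri_to_ac:
  "cubic_tri (to_ac \<circ> c) (to_ac_vec u) (to_ac_vec v) (to_ac_vec w) = to_ac (cubic_tri c u v w)"
  unfolding cubic_tri_def to_ac_sum
  by (rule sum.cong) (auto simp: to_ac_vec_def split: prod.split)

lemma cubic_to_ac [simp]:
  "cubic_eval (to_ac \<circ> c) (to_ac_vec u) = to_ac (cubic_eval c u)"
  "cubic_D (to_ac \<circ> c) (to_ac_vec u) (to_ac_vec v) = to_ac (cubic_D c u v)"
  "cubic_T (to_ac \<circ> c) (to_ac_vec u) (to_ac_vec v) (to_ac_vec w) = to_ac (cubic_T c u v w)"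
  by (simp_all add: cubic_eval_tri cubic_D_def cubic_T_def cubic_tri_to_ac)

section \<open>Bases of four-space\<close>

definition basis4 :: "'b::field^4 \<Rightarrow> 'b^4 \<Rightarrow> 'b^4 \<Rightarrow> 'b^4 \<Rightarrow> bool" where
  "basis4 p q g h \<longleftrightarrow> (\<forall>w. \<exists>a b c d. w = a *s p + b *s q + c *s g + d *s h)"

lemma in_span4_iff:
  fixes p q g h w :: "'b::field^4"
  shows "w \<in> vec.span {p, q, g, h} \<longleftrightarrow> (\<exists>a b c d. w = a *s p + b *s q + c *s g + d *s h)"
  unfolding vec.span_breakdown_eq vec.span_empty singleton_iff
  by (simp add: algebra_simps)

text \<open>A dimension count. Distinctness of the vectors comes first in both directions, since a
  repetition would shrink the set.\<close>

lemma basis4_iff_indep: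
  fixes p q g h :: "'b::field^4"
  shows "basis4 p q g h \<longleftrightarrow>
    (\<forall>a b c d. a *s p + b *s q + c *s g + d *s h = 0 \<longrightarrow> a = 0 \<and> b = 0 \<and> c = 0 \<and> d = 0)"
    (is "_ \<longleftrightarrow> ?I")
proof -
  let ?B = "{p, q, g, h}"
  have dim: "vec.dim (UNIV :: ('b^4) set) = 4"
    by (subst vec_dim_card) simp
  have span: "basis4 p q g h \<longleftrightarrow> vec.span ?B = UNIV"
    by (auto simp: basis4_def set_eq_iff in_span4_iff)
  show ?thesis
  proof
    assume "basis4 p q g h"
    then have sp: "vec.span ?B = UNIV" by (simp add: span)
    have "4 \<le> card ?B" using vec.dim_le_card[of UNIV ?B] unfolding sp dim by simp
    then have dist: "p \<noteq> q" "p \<noteq> g" "p \<noteq> h" "q \<noteq> g" "q \<noteq> h" "g \<noteq> h"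
      by (auto simp: card_insert_if split: if_splits)
    then have "card ?B = 4" by simp
    then have ind: "vec.independent ?B"
      by (intro vec.card_le_dim_spanning[of _ UNIV]) (simp_all add: sp dim del: vec.dim_UNIV)
    show ?I
    proof (intro allI impI)
      fix a b c d assume eq: "a *s p + b *s q + c *s g + d *s h = 0"
      define f where "f = (\<lambda>v. if v = p then a else if v = q then b else if v = g then c else d)"
      have "(\<Sum>v\<in>?B. f v *s v) = 0"
        using dist eq by (simp add: f_def add.assoc)
      then have "f v = 0" if "v \<in> ?B" for v
        using vec.independentD[OF ind _ subset_refl] that by blast
      from this[of p] this[of q] this[of g] this[of h]
      show "a = 0 \<and> b = 0 \<and> c = 0 \<and> d = 0" using dist by (simp add: f_def)
    qed
  next
    assume I: ?I
    have dist: "p \<noteq> q" "p \<noteq> g" "p \<noteq> h" "q \<noteq> g" "q \<noteq> h" "g \<noteq> h"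
      using I[rule_format, of 1 "-1" 0 0] I[rule_format, of 1 0 "-1" 0]
        I[rule_format, of 1 0 0 "-1"] I[rule_format, of 0 1 "-1" 0]
        I[rule_format, of 0 1 0 "-1"] I[rule_format, of 0 0 1 "-1"]
      by (auto simp: vec_eq_iff)
    have "vec.independent ?B"
    proof
      assume "vec.dependent ?B"
      then obtain f where f: "\<exists>v\<in>?B. f v \<noteq> 0" "(\<Sum>v\<in>?B. f v *s v) = 0"
        using vec.dependent_finite[of ?B] by auto
      then have "f p *s p + f q *s q + f g *s g + f h *s h = 0"
        using dist by (simp add: add.assoc)
      then show False using I f(1) by blast
    qed
    moreover have "card ?B = 4" using dist by simp
    ultimately have "vec.span ?B = UNIV"
      using vec.card_ge_dim_independent[of ?B UNIV] unfolding dim by auto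
    then show "basis4 p q g h" by (simp add: span)
  qed
qed

lemma basis4D:
  assumes "basis4 p q g h" "a *s p + b *s q + c *s g + d *s h = 0"
  shows "a = 0" "b = 0" "c = 0" "d = 0"
  using assms unfolding basis4_iff_indep by blast+

lemma basis4E:
  assumes "basis4 p q g h"
  obtains a b c d where "w = a *s p + b *s q + c *s g + d *s h"
  using assms unfolding basis4_def by blast

text \<open>The standard basis vectors have entries 0 and 1, so their expansions over the small
  field carry over to the closure.\<close>

lemma basis4_to_ac:
  assumes "basis4 p q g h"
  shows "basis4 (to_ac_vec p) (to_ac_vec q) (to_ac_vec g) (to_ac_vec h)"
proof -
  let ?S = "vec.span {to_ac_vec p, to_ac_vec q, to_ac_vec g, to_ac_vec h}"
  have "axis j 1 \<in> ?S" for j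
  proof -
    obtain a b c d where "axis j 1 = a *s p + b *s q + c *s g + d *s h"
      using assms by (rule basis4E)
    moreover have "to_ac_vec (axis j 1) = axis j 1"
      by (auto simp: to_ac_vec_def axis_def vec_eq_iff)
    ultimately have "axis j 1 = to_ac a *s to_ac_vec p + to_ac b *s to_ac_vec q
        + to_ac c *s to_ac_vec g + to_ac d *s to_ac_vec h"
      by (metis to_ac_vec_add to_ac_vec_scale)
    then show ?thesis by (simp add: vec.span_add vec.span_scale vec.span_base)
  qed
  then have "(\<Sum>j\<in>UNIV. vec_nth w j *s axis j 1) \<in> ?S" for w
    by (intro vec.span_sum vec.span_scale)
  then have all: "w \<in> ?S" for w by (simp add: basis_expansion)
  then show ?thesis by (simp add: basis4_def in_span4_iff)
qed

section \<open>Zeros of binary quadratic forms and of a cubic polynomial\<close>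

lemma binary_quadratic_root:
  fixes a b d :: "'b::alg_closed_field"
  obtains s t where "s \<noteq> 0 \<or> t \<noteq> 0" "s^2 * a + s * t * b + t^2 * d = 0"
proof (cases "d = 0")
  case True
  then show thesis using that[of 0 1] by simp
next
  case False
  then obtain x where "poly [:a, b, d:] x = 0"
    using alg_closed_imp_poly_has_root[of "[:a, b, d:]"] by auto
  then show thesis using that[of 1 x] by (simp add: power2_eq_square algebra_simps)
qed

text \<open>The polynomial \<open>?p\<close> has at most three roots, so a field with at least four
  elements contains a non-root. Its main use is to find a point of a line that is not its own
  partner under the Gauss map.\<close>

lemma exists_nonzero_sq_neq:
  fixes \<omega> \<mu> :: "'a::field"
  assumes "infinite (UNIV :: 'a set) \<or> card (UNIV :: 'a set) \<ge> 4" "\<omega> \<noteq> 0"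
  obtains x where "x \<noteq> 0" "\<omega> * x^2 \<noteq> \<mu>"
proof -
  let ?p = "[:0, -\<mu>, 0, \<omega>:]"
  have fin: "finite {x. poly ?p x = 0}" and "card {x. poly ?p x = 0} \<le> degree ?p"
    using assms(2) by (intro poly_roots_finite card_poly_roots_bound; simp)+
  then have card: "card {x. poly ?p x = 0} < 4" using assms(2) by (simp del: poly_pCons)
  have "{x. poly ?p x = 0} \<noteq> UNIV"
  proof
    assume "{x. poly ?p x = 0} = UNIV"
    then show False using fin card assms(1) by (metis not_le)
  qed
  then obtain x where "poly ?p x \<noteq> 0" by auto
  then show thesis using that[of x] by (auto simp: power2_eq_square algebra_simps)
qed

section \<open>Sets closed under secants and tangents\<close>

text \<open>The set \<open>Sp\<close> collects the nonzero representatives of the generated points. With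
  \<open>F(s u + t v) = s\<^sup>2t D(u,v) + st\<^sup>2 D(v,u)\<close> on the line through two points \<open>u\<close>, \<open>v\<close> of the
  surface, the third point is \<open>D(v,u) u - D(u,v) v\<close>.\<close>
locale secant_closed =
  fixes c :: "(4 \<Rightarrow> nat) \<Rightarrow> 'a::field" and Sp :: "('a^4) set"
  assumes card4: "infinite (UNIV :: 'a set) \<or> card (UNIV :: 'a set) \<ge> 4"
    and smooth: "smooth_cubic c"
    and Sp_nonzero: "u \<in> Sp \<Longrightarrow> u \<noteq> 0"
    and Sp_F: "u \<in> Sp \<Longrightarrow> cubic_eval c u = 0"
    and Sp_scale: "u \<in> Sp \<Longrightarrow> a \<noteq> 0 \<Longrightarrow> a *s u \<in> Sp"
    and Sp_third: "u \<in> Sp \<Longrightarrow> v \<in> Sp \<Longrightarrow> cubic_D c u v \<noteq> 0 \<or> cubic_D c v u \<noteq> 0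
      \<Longrightarrow> cubic_D c v u *s u + (- cubic_D c u v) *s v \<in> Sp"
    and Sp_second: "u \<in> Sp \<Longrightarrow> cubic_eval c v = 0 \<Longrightarrow> cubic_D c u v \<noteq> 0 \<or> cubic_D c v u \<noteq> 0
      \<Longrightarrow> cubic_D c v u *s u + (- cubic_D c u v) *s v \<in> Sp \<Longrightarrow> v \<in> Sp"
    and Sp_tangent: "u \<in> Sp \<Longrightarrow> cubic_D c u v = 0 \<Longrightarrow> cubic_D c v u \<noteq> 0 \<or> cubic_eval c v \<noteq> 0
      \<Longrightarrow> cubic_eval c v *s u + (- cubic_D c v u) *s v \<in> Sp"
begin

abbreviation "F \<equiv> cubic_eval c"
abbreviation "D \<equiv> cubic_D c"
abbreviation "T \<equiv> cubic_T c"

lemma Sp_unscale: "a *s u \<in> Sp \<Longrightarrow> u \<in> Sp"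
  using Sp_nonzero[of "a *s u"] Sp_scale[of "a *s u" "inverse a"]
  by (cases "a = 0") (auto simp: vector_smult_assoc)

lemma Sp_tangent_pt:
  assumes "u \<in> Sp" "D u v = 0" "D v u \<noteq> 0" "F v = 0"
  shows "v \<in> Sp"
proof -
  have "(- D v u) *s v \<in> Sp" using Sp_tangent[of u v] assms by simp
  then show ?thesis by (rule Sp_unscale)
qed

lemma T_perms:
  "T p y q = T p q y" "T q p y = T p q y" "T q y p = T p q y" "T y p q = T p q y" "T y q p = T p q y"
  by (metis cubic_T_commute)+

text \<open>Smoothness is given over the closure. The standard basis vectors are rational, so
  derivatives along them that vanish over the small field also vanish there.\<close>

lemma smooth_pt:
  assumes "u \<noteq> 0" "F u = 0"
  obtains w where "D u w \<noteq> 0"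
proof -
  obtain w where w: "cubic_D (to_ac \<circ> c) (to_ac_vec u) w \<noteq> 0"
    using smooth_cubicD[OF smooth, of "to_ac_vec u"] assms by auto
  have "\<exists>j. D u (axis j 1) \<noteq> 0"
  proof (rule ccontr)
    assume "\<not> ?thesis"
    moreover have "to_ac_vec (axis j 1) = axis j 1" for j :: 4
      by (auto simp: to_ac_vec_def axis_def vec_eq_iff)
    ultimately have "cubic_D (to_ac \<circ> c) (to_ac_vec u) (axis j 1) = 0" for j
      by (metis cubic_to_ac(2) to_ac_0)
    then show False using w unfolding cubic_D_eq_sum_partial[of _ _ w] cubic_partial_eq_D by simp
  qed
  then show thesis using that by blast
qed

definition line_in :: "'a^4 \<Rightarrow> 'a^4 \<Rightarrow> bool" where
  "line_in p q \<longleftrightarrow> (\<forall>a b. a \<noteq> 0 \<or> b \<noteq> 0 \<longrightarrow> a *s p + b *s q \<in> Sp)"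

lemma line_inD: "line_in p q \<Longrightarrow> a \<noteq> 0 \<or> b \<noteq> 0 \<Longrightarrow> a *s p + b *s q \<in> Sp"
  by (simp add: line_in_def)

lemma line_in_ends: assumes "line_in p q" shows "p \<in> Sp" "q \<in> Sp"
  using line_inD[OF assms, of 1 0] line_inD[OF assms, of 0 1] by simp_all

lemma line_in_comb:
  assumes l: "line_in (a *s p + b *s q) (a' *s p + b' *s q)" and det: "a * b' - b * a' \<noteq> 0"
  shows "line_in p q"
  unfolding line_in_def
proof (intro allI impI)
  fix x y :: 'a assume xy: "x \<noteq> 0 \<or> y \<noteq> 0"
  let ?d = "a * b' - b * a'"
  \<comment> \<open>Cramer's coefficients, left undivided by the determinant
    \<open>?d\<close>.\<close>
  let ?s = "(x * b' - y * a')" and ?t = "(a * y - b * x)"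
  have eqs: "?d * x = a * ?s + a' * ?t" "?d * y = b * ?s + b' * ?t" by (simp_all add: algebra_simps)
  have "?s \<noteq> 0 \<or> ?t \<noteq> 0"
  proof (rule ccontr)
    assume "\<not> ?thesis"
    then have st: "?s = 0" "?t = 0" by blast+
    have "?d * x = 0" "?d * y = 0" unfolding eqs st by simp_all
    then show False using xy det by simp
  qed
  then have "?s *s (a *s p + b *s q) + ?t *s (a' *s p + b' *s q) \<in> Sp" by (rule line_inD[OF l])
  also have "?s *s (a *s p + b *s q) + ?t *s (a' *s p + b' *s q) = ?d *s (x *s p + y *s q)"
    by (simp add: vec_eq_iff algebra_simps)
  finally show "x *s p + y *s q \<in> Sp" by (rule Sp_unscale)
qed

section \<open>Tangent plane sections with two distinct points of tangency on the line\<close>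

text \<open>In the plane spanned by \<open>p\<close>, \<open>q\<close>, \<open>y\<close> the surface is
  \<open>t (T(p,q,y) a b + F(y) t\<^sup>2) = 0\<close>: the line \<open>t = 0\<close> and a conic meeting it in \<open>p\<close> and \<open>q\<close>,
  which splits iff \<open>F(y) = 0\<close>.\<close>
definition bitangent :: "'a^4 \<Rightarrow> 'a^4 \<Rightarrow> 'a^4 \<Rightarrow> bool" where
  "bitangent p q y \<longleftrightarrow> F p = 0 \<and> F q = 0 \<and> D p q = 0 \<and> D q p = 0 \<and> D p y = 0 \<and> D q y = 0
     \<and> D y p = 0 \<and> D y q = 0 \<and> T p q y \<noteq> 0"

lemma bitangent_simps:
  assumes "bitangent p q y"
  shows "F p = 0" "F q = 0" "D p q = 0" "D q p = 0" "D p y = 0" "D q y = 0" "D y p = 0" "D y q = 0"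
  using assms by (auto simp: bitangent_def)

lemma bitangent_T: "bitangent p q y \<Longrightarrow> T p q y \<noteq> 0"
  by (simp add: bitangent_def)

lemma bitangent_sym: "bitangent p q y \<Longrightarrow> bitangent q p y"
  by (simp add: bitangent_def T_perms[where p=p and q=q and y=y])

lemma bitangent_rot: "bitangent p q y \<Longrightarrow> F y = 0 \<Longrightarrow> bitangent q y p"
  by (simp add: bitangent_def T_perms[where p=p and q=q and y=y])

text \<open>The tangency conditions leave the section t (T a b + (D y p) a t + (D y q) b t + F(y)
  t^2). As T is nonzero, translating \<open>y\<close> along the line removes the two middle
  terms.\<close>

lemma bitangent_adjust:
  assumes "F p = 0" "F q = 0" "D p q = 0" "D q p = 0" "D p y = 0" "D q y = 0" "T p q y \<noteq> 0"
  obtains a b where "bitangent p q (y + a *s p + b *s q)"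
proof -
  let ?t = "T p q y"
  have "bitangent p q (y + (- D y q / ?t) *s p + (- D y p / ?t) *s q)"
    unfolding bitangent_def using assms
    by (simp add: cubic_simps T_perms[where p=p and q=q and y=y])
  then show thesis by (rule that)
qed

text \<open>The conic is smooth here. Tangent lines at \<open>p\<close> produce conic points with
  parameter \<open>\<beta>\<close>, and a line through two of these, counted with multiplicity,
  reaches the given point of \<open>p q\<close>.\<close>

lemma conic_line_in:
  assumes bt: "bitangent p q y" and y: "F y \<noteq> 0" and p: "p \<in> Sp" and a: "a \<noteq> 0"
  shows "a *s p + b *s q \<in> Sp"
proof (cases "b = 0")
  case True
  then show ?thesis using Sp_scale[OF p a] by simp
next
  case b: False
  define t where "t = T p q y"
  define f where "f = F y"
  note [simp] = bitangent_simps[OF bt]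
  have t: "T p q y = t" "T p y q = t" "T q p y = t" "T q y p = t" "T y p q = t" "T y q p = t"
    by (simp_all add: t_def T_perms[where p=p and q=q and y=y])
  have "t \<noteq> 0" "f \<noteq> 0" using bitangent_T[OF bt] y by (simp_all add: t_def f_def)
  have R: "f *s p + (- (t * \<beta>)) *s (\<beta> *s q + y) \<in> Sp" if "\<beta> \<noteq> 0" for \<beta>
    using Sp_tangent[OF p, of "\<beta> *s q + y"] \<open>f \<noteq> 0\<close>
    by (simp add: cubic_simps t flip: f_def) (simp add: mult.commute)
  define U where "U = f *s p + (-t) *s (q + y)"
  have U: "U \<in> Sp" using R[of 1] by (simp add: U_def)
  let ?X = "a *s p + b *s q"
  have D1: "D ?X U = - (t^2 * a * b)"
    by (simp add: U_def cubic_simps t power2_eq_square algebra_simps)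
  have D2: "D U ?X = a * t^3 - b * f * t^2"
    by (simp add: U_def cubic_simps t power2_eq_square power3_eq_cube algebra_simps)
  \<comment> \<open>The parameter of the other conic point on the line through \<open>U\<close> and
    \<open>?X\<close>.\<close>
  define \<beta> where "\<beta> = b * f / (a * t)"
  have "\<beta> \<noteq> 0" using \<open>t \<noteq> 0\<close> \<open>f \<noteq> 0\<close> a b by (simp add: \<beta>_def)
  have bf: "b * f = \<beta> * a * t" using \<open>t \<noteq> 0\<close> a by (simp add: \<beta>_def)
  have "f * (b^2 * f * t^2) = (b * f)^2 * t^2" "f * (a * b * t^3) = a * (b * f) * t^3"
    by (simp_all add: power2_eq_square algebra_simps)
  then have coeffs: "f * (b^2 * f * t^2) = a^2 * t^4 * \<beta>^2" "f * (a * b * t^3) = a^2 * t^4 * \<beta>"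
    unfolding bf by (simp_all add: power2_eq_square power3_eq_cube power4_eq_xxxx mult_ac)
  have third: "D ?X U *s U + (- D U ?X) *s ?X
      = (- (a^2 * t^3)) *s p + (b^2 * f * t^2) *s q + (a * b * t^3) *s y"
    unfolding D1 D2 by (simp add: U_def vec_eq_iff power2_eq_square power3_eq_cube algebra_simps)
  have "f *s (D ?X U *s U + (- D U ?X) *s ?X)
      = (- (f * (a^2 * t^3))) *s p + (f * (b^2 * f * t^2)) *s q + (f * (a * b * t^3)) *s y"
    unfolding third by (simp add: vec_eq_iff algebra_simps)
  also have "\<dots> = (- (a^2 * t^3)) *s (f *s p + (- (t * \<beta>)) *s (\<beta> *s q + y))"
    unfolding coeffs
    by (simp add: vec_eq_iff power2_eq_square power3_eq_cube power4_eq_xxxx algebra_simps)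
  also have "\<dots> \<in> Sp"
    using R[OF \<open>\<beta> \<noteq> 0\<close>] \<open>t \<noteq> 0\<close> a by (intro Sp_scale) auto
  finally have "D ?X U *s U + (- D U ?X) *s ?X \<in> Sp" by (rule Sp_unscale)
  moreover have "F ?X = 0" by (simp add: cubic_simps)
  moreover have "D U ?X \<noteq> 0 \<or> D ?X U \<noteq> 0" unfolding D1 using a b \<open>t \<noteq> 0\<close> by simp
  ultimately show ?thesis using Sp_second[OF U] by blast
qed

text \<open>The section is the triangle \<open>p\<close>, \<open>q\<close>, \<open>y\<close>, and
  tangent lines at the vertex \<open>p\<close> meet the opposite side in their residual
  point.\<close>

lemma triangle_opposite:
  assumes bt: "bitangent p q y" and y: "F y = 0" and p: "p \<in> Sp" and b: "b \<noteq> 0"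
  shows "b *s q + y \<in> Sp"
proof (rule Sp_tangent_pt[OF p])
  show "D p (b *s q + y) = 0" "F (b *s q + y) = 0"
    using bitangent_simps[OF bt] y by (simp_all add: cubic_simps)
  show "D (b *s q + y) p \<noteq> 0"
    using bitangent_simps[OF bt] bitangent_T[OF bt] b
    by (simp add: cubic_simps T_perms[where p=p and q=q and y=y])
qed

lemma triangle_line_in:
  assumes bt: "bitangent p q y" and y: "F y = 0" and p: "p \<in> Sp" and q: "q \<in> Sp"
  shows "line_in p q"
  unfolding line_in_def
proof (intro allI impI)
  fix a b :: 'a assume ab: "a \<noteq> 0 \<or> b \<noteq> 0"
  show "a *s p + b *s q \<in> Sp"
  proof (cases "a = 0 \<or> b = 0")
    case True
    then show ?thesis using ab Sp_scale[OF p, of a] Sp_scale[OF q, of b] by auto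
  next
    case False
    \<comment> \<open>Points on the other two sides; their difference is the wanted point, so the
      secant joining them passes through it.\<close>
    let ?U = "a *s p + y" and ?V = "(-b) *s q + y"
    have U: "?U \<in> Sp" using triangle_opposite[OF bitangent_sym[OF bt] y q] False by blast
    have V: "?V \<in> Sp" using triangle_opposite[OF bt y p, of "-b"] False by simp
    have "D ?U ?V = - (a * b * T p q y)" "D ?V ?U = - (a * b * T p q y)"
      using bitangent_simps[OF bt] y by (simp_all add: cubic_simps T_perms[where p=p and q=q and y=y])
    then have "(- (a * b * T p q y)) *s ?U + (a * b * T p q y) *s ?V \<in> Sp"
      using Sp_third[OF U V] False bitangent_T[OF bt] by simp
    also have "(- (a * b * T p q y)) *s ?U + (a * b * T p q y) *s ?V
        = (- (a * b * T p q y)) *s (a *s p + b *s q)"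
      by (simp add: vec_eq_iff algebra_simps)
    finally show ?thesis by (rule Sp_unscale)
  qed
qed

text \<open>The Gauss map along a line has degree two; when it identifies two distinct points, it is
  separable, and at most two points of the line equal their own partner.\<close>
lemma bitangent_another:
  assumes bt: "bitangent p q y"
  obtains \<beta> \<gamma> y' where "\<beta> \<noteq> 0" "\<gamma> \<noteq> 0" "\<beta> \<noteq> \<gamma>" "bitangent (p + \<beta> *s q) (p + \<gamma> *s q) y'"
proof -
  note [simp] = bitangent_simps[OF bt]
  define t where "t = T p q y"
  have t: "T p q y = t" "T p y q = t" "T q p y = t" "T q y p = t" "T y p q = t" "T y q p = t"
    by (simp_all add: t_def T_perms[where p=p and q=q and y=y])
  have "t \<noteq> 0" using bitangent_T[OF bt] by (simp_all add: t_def)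
  have pq: "p \<noteq> 0" "q \<noteq> 0"
    using \<open>t \<noteq> 0\<close> cubic_T_scale(1)[of c 0 p q y] cubic_T_scale(2)[of c p 0 q y] by (auto simp: t_def)
  obtain z0 where z0: "D p z0 \<noteq> 0" using smooth_pt[OF pq(1)] by auto
  \<comment> \<open>\<open>z\<close> lies outside the tangent plane at \<open>p\<close>, and the
    multiple of \<open>y\<close> makes \<open>T p q z\<close> vanish. On \<open>y\<close> and
    \<open>z\<close> the derivative at p + b q then takes the values b t and \<mu> + \<omega>
    b^2.\<close>
  define z where "z = z0 + (- T p q z0 / t) *s y"
  define \<mu> \<omega> where "\<mu> = D p z" and "\<omega> = D q z"
  have "\<mu> \<noteq> 0" using z0 by (simp add: \<mu>_def z_def cubic_simps)
  have z: "T p q z = 0" "T q p z = 0" using \<open>t \<noteq> 0\<close> by (simp_all add: z_def cubic_simps t T_perms[where p=p and q=q and y=z0])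
  \<comment> \<open>The functionals \<open>D p\<close>, \<open>T p q\<close>, \<open>T q y\<close>
    and \<open>T p y\<close> isolate the coefficients.\<close>
  have basis: "basis4 p q y z"
    unfolding basis4_iff_indep
  proof (intro allI impI)
    fix a b d e assume 0: "a *s p + b *s q + d *s y + e *s z = 0"
    have D0: "D u (a *s p + b *s q + d *s y + e *s z) = 0"
      and T0: "T u v (a *s p + b *s q + d *s y + e *s z) = 0" for u v
      using 0 cubic_T_scale(3)[of c u v 0 0] by simp_all
    have "e = 0" using D0[of p] \<open>\<mu> \<noteq> 0\<close> by (simp add: cubic_simps \<mu>_def)
    moreover have "d = 0" using T0[of p q] \<open>t \<noteq> 0\<close> by (simp add: cubic_simps t z)
    ultimately show "a = 0 \<and> b = 0 \<and> d = 0 \<and> e = 0"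
      using T0[of q y] T0[of p y] \<open>t \<noteq> 0\<close> by (simp add: cubic_simps t)
  qed
  have "\<omega> \<noteq> 0"
  proof -
    obtain w where "D q w \<noteq> 0" using smooth_pt[OF pq(2)] by auto
    moreover obtain a b d e where "w = a *s p + b *s q + d *s y + e *s z"
      using basis by (rule basis4E)
    ultimately show ?thesis by (auto simp: cubic_simps \<omega>_def)
  qed
  then obtain \<beta> where \<beta>: "\<beta> \<noteq> 0" "\<omega> * \<beta>^2 \<noteq> \<mu>"
    using exists_nonzero_sq_neq[OF card4] by metis
  \<comment> \<open>Distinct parameters have the same tangent plane iff their product is \<mu> /
    \<omega>; the choice of \<open>\<beta>\<close> excludes a coincidence.\<close>
  define \<gamma> where "\<gamma> = \<mu> / (\<omega> * \<beta>)"
  have \<gamma>: "\<mu> = \<omega> * \<beta> * \<gamma>" "\<gamma> \<noteq> 0" using \<open>\<omega> \<noteq> 0\<close> \<open>\<mu> \<noteq> 0\<close> \<beta>(1) by (simp_all add: \<gamma>_def)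
  have ne: "\<beta> \<noteq> \<gamma>" using \<gamma>(1) \<beta>(2) by (auto simp: power2_eq_square)
  \<comment> \<open>Together with the line, \<open>y1\<close> spans the common tangent
    plane.\<close>
  define y1 where "y1 = (- (\<mu> + \<omega> * \<beta>^2)) *s y + (\<beta> * t) *s z"
  let ?Q = "p + \<beta> *s q" and ?Q' = "p + \<gamma> *s q"
  have D1: "D ?Q y1 = 0" "D ?Q' y1 = 0"
    by (simp_all add: y1_def cubic_simps t z flip: \<mu>_def \<omega>_def)
       (simp_all add: \<gamma>(1) power2_eq_square algebra_simps)
  have "T ?Q ?Q' y1 = - (\<omega> * \<beta> * t * (\<beta> - \<gamma>)^2)"
    by (simp add: y1_def cubic_simps t z flip: \<mu>_def \<omega>_def)
       (simp add: \<gamma>(1) power2_eq_square algebra_simps)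
  then have T1: "T ?Q ?Q' y1 \<noteq> 0" using ne \<open>\<omega> \<noteq> 0\<close> \<beta>(1) \<open>t \<noteq> 0\<close> by simp
  have line: "F ?Q = 0" "F ?Q' = 0" "D ?Q ?Q' = 0" "D ?Q' ?Q = 0" by (simp_all add: cubic_simps)
  obtain a b where "bitangent ?Q ?Q' (y1 + a *s ?Q + b *s ?Q')"
    using line D1 T1 by (rule bitangent_adjust)
  then show thesis using that \<beta>(1) \<gamma>(2) ne by blast
qed

text \<open>A second bitangent pair can be chosen among the inner points; its plane also reaches
  \<open>p\<close> and \<open>q\<close>.\<close>

lemma line_in_if_inner:
  assumes bt: "bitangent p q y" and inner: "\<And>a b. a \<noteq> 0 \<Longrightarrow> b \<noteq> 0 \<Longrightarrow> a *s p + b *s q \<in> Sp"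
  shows "line_in p q"
proof -
  obtain \<beta> \<gamma> y' where *: "\<beta> \<noteq> 0" "\<gamma> \<noteq> 0" "\<beta> \<noteq> \<gamma>"
    and bt': "bitangent (p + \<beta> *s q) (p + \<gamma> *s q) y'"
    using bt by (rule bitangent_another)
  let ?Q = "p + \<beta> *s q" and ?Q' = "p + \<gamma> *s q"
  have Q: "?Q \<in> Sp" "?Q' \<in> Sp" using inner[of 1 \<beta>] inner[of 1 \<gamma>] * by simp_all
  have "line_in ?Q ?Q'"
  proof (cases "F y' = 0")
    case True
    then show ?thesis using triangle_line_in[OF bt' _ Q] by blast
  next
    case False
    show ?thesis unfolding line_in_def
    proof (intro allI impI)
      fix a b :: 'a assume "a \<noteq> 0 \<or> b \<noteq> 0"
      then show "a *s ?Q + b *s ?Q' \<in> Sp"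
        using conic_line_in[OF bt' False Q(1), of a b] Sp_scale[OF Q(2), of b] by (cases "a = 0") auto
    qed
  qed
  then show ?thesis using line_in_comb[of 1 p \<beta> q 1 \<gamma>] *(3) by simp
qed

text \<open>One generated point of tangency suffices. In the triangle case the side
  \<open>q y\<close> is filled first, which supplies the vertex \<open>q\<close>.\<close>

lemma bitangent_line_in:
  assumes bt: "bitangent p q y" and p: "p \<in> Sp"
  shows "line_in p q" and "F y = 0 \<Longrightarrow> line_in q y"
proof -
  show qy: "line_in q y" if y: "F y = 0"
  proof (rule line_in_if_inner[OF bitangent_rot[OF bt y]])
    fix a b :: 'a assume "a \<noteq> 0" "b \<noteq> 0"
    then have "b *s ((a / b) *s q + y) \<in> Sp"
      using triangle_opposite[OF bt y p, of "a / b"] by (intro Sp_scale) auto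
    then show "a *s q + b *s y \<in> Sp"
      using \<open>b \<noteq> 0\<close> by (simp add: vector_add_ldistrib vector_smult_assoc)
  qed
  show "line_in p q"
  proof (cases "F y = 0")
    case True
    then show ?thesis using triangle_line_in[OF bt True p] qy line_in_ends by blast
  next
    case False
    then show ?thesis using line_in_if_inner[OF bt] conic_line_in[OF bt False p] by blast
  qed
qed

section \<open>Two skew lines\<close>

lemma complete_det:
  fixes a b :: 'a
  assumes "a \<noteq> 0 \<or> b \<noteq> 0"
  obtains a' b' where "a * b' - b * a' \<noteq> 0"
  using assms that[of 1 0] that[of 0 1] by (cases "a = 0") auto

text \<open>Coordinates adapted to the skew pair: the basis condition encodes skewness, and the
  equations put the lines \<open>p q\<close> and \<open>g h\<close> on the surface.\<close>

definition frame :: "'a^4 \<Rightarrow> 'a^4 \<Rightarrow> 'a^4 \<Rightarrow> 'a^4 \<Rightarrow> bool" where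
  "frame p q g h \<longleftrightarrow> basis4 p q g h \<and> F p = 0 \<and> F q = 0 \<and> D p q = 0 \<and> D q p = 0
     \<and> F g = 0 \<and> F h = 0 \<and> D g h = 0 \<and> D h g = 0"

lemma frame_simps:
  assumes "frame p q g h"
  shows "F p = 0" "F q = 0" "D p q = 0" "D q p = 0" "F g = 0" "F h = 0" "D g h = 0" "D h g = 0"
  using assms by (auto simp: frame_def)

lemma frame_basis: "frame p q g h \<Longrightarrow> basis4 p q g h"
  by (simp add: frame_def)

lemma frame_lines: "frame p q g h \<Longrightarrow> frame g h p q"
  unfolding frame_def basis4_def by (metis (no_types, opaque_lifting) add.assoc add.commute)

lemma frame_comb:
  assumes fr: "frame p q g h" and det: "a * b' - b * a' \<noteq> 0"
  shows "frame (a *s p + b *s q) (a' *s p + b' *s q) g h"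
proof -
  have "basis4 (a *s p + b *s q) (a' *s p + b' *s q) g h"
    unfolding basis4_iff_indep
  proof (intro allI impI)
    fix x y z w assume "x *s (a *s p + b *s q) + y *s (a' *s p + b' *s q) + z *s g + w *s h = 0"
    then have "(x * a + y * a') *s p + (x * b + y * b') *s q + z *s g + w *s h = 0"
      by (simp add: vec_eq_iff algebra_simps)
    note * = basis4D[OF frame_basis[OF fr] this]
    have "(a * b' - b * a') * x = b' * (x * a + y * a') - a' * (x * b + y * b')"
      "(a * b' - b * a') * y = a * (x * b + y * b') - b * (x * a + y * a')"
      by (simp_all add: algebra_simps)
    then show "x = 0 \<and> y = 0 \<and> z = 0 \<and> w = 0" using * det by simp
  qed
  then show ?thesis
    using frame_simps[OF fr] by (simp add: frame_def cubic_simps)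
qed

lemma frame_swap: "frame p q g h \<Longrightarrow> frame q p g h"
  using frame_comb[of p q g h 0 0 1 1] by simp

lemma frame_nonzero:
  assumes "frame p q g h" shows "p \<noteq> 0"
  using basis4D(1)[OF frame_basis[OF assms], of 1 0 0 0] by auto

text \<open>The tangent plane at \<open>p\<close> contains \<open>p q\<close>, so it cannot contain
  both \<open>g\<close> and \<open>h\<close>.\<close>

lemma frame_smooth:
  assumes fr: "frame p q g h" shows "D p g \<noteq> 0 \<or> D p h \<noteq> 0"
proof -
  obtain w where w: "D p w \<noteq> 0"
    using smooth_pt[OF frame_nonzero[OF fr]] frame_simps[OF fr] by auto
  obtain a b d e where "w = a *s p + b *s q + d *s g + e *s h"
    using frame_basis[OF fr] by (rule basis4E)
  then show ?thesis using w frame_simps[OF fr] by (auto simp: cubic_simps)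
qed

text \<open>Otherwise the plane through the line \<open>p q\<close> and \<open>g\<close> is tangent along the whole line, and a
  root over the algebraic closure of the quadratic form \<open>D(s p + t q, h)\<close> is a singular point.\<close>
lemma frame_no_common_tangent:
  assumes fr: "frame p q g h" shows "D p g \<noteq> 0 \<or> D q g \<noteq> 0 \<or> T p q g \<noteq> 0"
proof (rule ccontr)
  assume neg: "\<not> ?thesis"
  let ?c = "to_ac \<circ> c" and ?v = to_ac_vec
  obtain s t where st: "s \<noteq> 0 \<or> t \<noteq> 0"
    "s^2 * to_ac (D p h) + s * t * to_ac (T p q h) + t^2 * to_ac (D q h) = 0"
    by (rule binary_quadratic_root)
  define x where "x = s *s ?v p + t *s ?v q"
  note basis = basis4_to_ac[OF frame_basis[OF fr]]
  have "x \<noteq> 0" using basis4D(1,2)[OF basis, of s t 0 0] st(1) by (auto simp: x_def)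
  moreover have "cubic_eval ?c x = 0"
    using frame_simps[OF fr] by (simp add: x_def cubic_simps)
  ultimately obtain w where w: "cubic_D ?c x w \<noteq> 0"
    using smooth_cubicD[OF smooth] by blast
  have "cubic_D ?c x (?v p) = 0" "cubic_D ?c x (?v q) = 0" "cubic_D ?c x (?v g) = 0"
    using frame_simps[OF fr] neg by (simp_all add: x_def cubic_simps)
  moreover have "cubic_D ?c x (?v h) = 0"
    using st(2) by (simp add: x_def cubic_simps algebra_simps)
  moreover obtain a b d e where "w = a *s ?v p + b *s ?v q + d *s ?v g + e *s ?v h"
    using basis by (rule basis4E)
  ultimately show False using w by (simp add: cubic_D_add_right cubic_D_scale_right)
qed

text \<open>\<open>g'\<close> is the intersection of \<open>g h\<close> with the tangent plane at
  \<open>p\<close>, which is then spanned by \<open>p\<close>, \<open>q\<close>,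
  \<open>g'\<close>.\<close>

lemma frame_tangent:
  assumes fr: "frame p q g h"
  obtains g' h' where "frame p q g' h'" "D p g' = 0" "D p h' \<noteq> 0" "line_in g' h' \<Longrightarrow> line_in g h"
proof -
  define a b where "a = D p h" and "b = - D p g"
  have ab: "a \<noteq> 0 \<or> b \<noteq> 0" using frame_smooth[OF fr] by (auto simp: a_def b_def)
  obtain a' b' where det: "a * b' - b * a' \<noteq> 0"
    using ab by (rule complete_det)
  let ?g = "a *s g + b *s h" and ?h = "a' *s g + b' *s h"
  have fr': "frame p q ?g ?h" using frame_comb[OF frame_lines[OF fr] det] by (rule frame_lines)
  moreover have g: "D p ?g = 0" by (simp add: cubic_simps a_def b_def)
  moreover have "D p ?h \<noteq> 0" using frame_smooth[OF fr'] g by simp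
  ultimately show thesis using that line_in_comb[OF _ det] by blast
qed

text \<open>For a point \<open>p\<close> of the surface this fails iff the tangent plane section at \<open>p\<close> is a cone with
  vertex \<open>p\<close>, that is, three lines through \<open>p\<close>.\<close>
definition regular :: "'a^4 \<Rightarrow> bool" where
  "regular p \<longleftrightarrow> (\<exists>w. D p w = 0 \<and> D w p \<noteq> 0)"

lemma regularI: "D p w = 0 \<Longrightarrow> D w p \<noteq> 0 \<Longrightarrow> regular p"
  by (auto simp: regular_def)

text \<open>For w = a p + b q + d g in the tangent plane, \<open>D w p\<close> equals d (b T p q g +
  d D g p).\<close>

lemma frame_regular:
  assumes fr: "frame p q g h" and g: "D p g = 0" and h: "D p h \<noteq> 0"
  shows "regular p \<longleftrightarrow> T p q g \<noteq> 0 \<or> D g p \<noteq> 0"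
proof
  assume "regular p"
  then obtain w where w: "D p w = 0" "D w p \<noteq> 0" by (auto simp: regular_def)
  obtain a b d e where w_eq: "w = a *s p + b *s q + d *s g + e *s h"
    using frame_basis[OF fr] by (rule basis4E)
  have "e = 0" using w(1) g h frame_simps[OF fr] by (simp add: w_eq cubic_simps)
  then show "T p q g \<noteq> 0 \<or> D g p \<noteq> 0"
    using w(2) g frame_simps[OF fr]
    by (auto simp: w_eq cubic_simps T_perms[where p=p and q=q and y=g])
next
  assume "T p q g \<noteq> 0 \<or> D g p \<noteq> 0"
  moreover have "D (q + g) p = T p q g + D g p" "D p (q + g) = 0"
    using g frame_simps[OF fr] by (simp_all add: cubic_simps T_perms[where p=p and q=q and y=g])
  ultimately show "regular p"
    using g by (cases "D g p = 0") (auto intro: regularI)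
qed

text \<open>The section is t ((D q g) b^2 + (D g p) a t), the line and a smooth conic touching it at
  \<open>p\<close>. Tangent lines at \<open>p\<close> yield the other conic points, and lines from
  \<open>g\<close> through these sweep out \<open>p q\<close>.\<close>

lemma tangent_conic_line_in:
  assumes F: "F p = 0" "F q = 0" "D p q = 0" "D q p = 0" "D p g = 0" "F g = 0" "D g q = 0" "T p q g = 0"
    and d: "D q g \<noteq> 0" and e: "D g p \<noteq> 0" and p: "p \<in> Sp"
  shows "line_in p q"
  unfolding line_in_def
proof (intro allI impI)
  fix a b :: 'a assume ab: "a \<noteq> 0 \<or> b \<noteq> 0"
  define d where "d = D q g"
  define e where "e = D g p"
  have de: "d \<noteq> 0" "e \<noteq> 0" using assms by (simp_all add: d_def e_def)
  note simps = F cubic_simps T_perms[where p=p and q=q and y=g] d_def[symmetric] e_def[symmetric]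
  have R: "(\<beta>^2 * d) *s p + (- e) *s (\<beta> *s q + g) \<in> Sp" for \<beta>
  proof -
    have "D p (\<beta> *s q + g) = 0" "D (\<beta> *s q + g) p = e" "F (\<beta> *s q + g) = \<beta>^2 * d"
      by (simp_all add: simps)
    then show ?thesis using Sp_tangent[OF p, of "\<beta> *s q + g"] de by simp
  qed
  have g: "g \<in> Sp" using R[of 0] Sp_unscale[of "-e" g] by simp
  let ?X = "a *s p + b *s q"
  show "?X \<in> Sp"
  proof (cases "b = 0")
    case True
    then show ?thesis using Sp_scale[OF p, of a] ab by simp
  next
    case False
    define \<beta> where "\<beta> = - (a * e) / (b * d)"
    have \<beta>: "b * d * \<beta> = - (a * e)" using de False by (simp add: \<beta>_def)
    have Dg: "D g ?X = a * e" "D ?X g = b^2 * d" "F ?X = 0"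
      by (simp_all add: simps)
    have "(b^2 * d) * (\<beta>^2 * d) = (b * d * \<beta>)^2" "(b^2 * d) * (e * \<beta>) = b * e * (b * d * \<beta>)"
      by (simp_all add: power2_eq_square mult_ac)
    then have coeffs: "(b^2 * d) * (\<beta>^2 * d) = (a * e)^2" "(b^2 * d) * (e * \<beta>) = - (b * e * a * e)"
      unfolding \<beta> by simp_all
    have "e *s (D ?X g *s g + (- D g ?X) *s ?X)
        = (- ((a * e)^2)) *s p + (- (b * e * a * e)) *s q + (e * (b^2 * d)) *s g"
      unfolding Dg by (simp add: vec_eq_iff power2_eq_square algebra_simps)
    also have "\<dots> = (- (b^2 * d)) *s ((\<beta>^2 * d) *s p + (- e) *s (\<beta> *s q + g))"
      unfolding coeffs[symmetric] by (simp add: vec_eq_iff power2_eq_square algebra_simps)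
    also have "\<dots> \<in> Sp" using Sp_scale[OF R[of \<beta>], of "- (b^2 * d)"] de False by simp
    finally have "D ?X g *s g + (- D g ?X) *s ?X \<in> Sp" by (rule Sp_unscale)
    moreover have "D g ?X \<noteq> 0 \<or> D ?X g \<noteq> 0" unfolding Dg using de False by simp
    ultimately show ?thesis using Sp_second[OF g Dg(3)] by blast
  qed
qed

lemma regular_line_in:
  assumes fr: "frame p q g h" and p: "p \<in> Sp" and reg: "regular p"
  shows "line_in p q"
proof -
  obtain g h where fr: "frame p q g h" and g: "D p g = 0" and h: "D p h \<noteq> 0"
    using fr by (rule frame_tangent)
  note [simp] = frame_simps[OF fr] g
  define t where "t = T p q g"
  have t: "T p q g = t" "T p g q = t" "T q p g = t" "T q g p = t" "T g p q = t" "T g q p = t"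
    by (simp_all add: t_def T_perms[where p=p and q=q and y=g])
  show ?thesis
  proof (cases "t = 0")
    case False
    \<comment> \<open>The other point of the line whose tangent plane is that of
      \<open>p\<close>.\<close>
    let ?q = "(- D q g) *s p + t *s q"
    have pre: "F p = 0" "F ?q = 0" "D p ?q = 0" "D ?q p = 0" "D p g = 0" "D ?q g = 0" "T p ?q g \<noteq> 0"
      using False by (simp_all add: cubic_simps t power2_eq_square algebra_simps)
    obtain a b where "bitangent p ?q (g + a *s p + b *s ?q)"
      using pre by (rule bitangent_adjust)
    then have "line_in p ?q" using bitangent_line_in(1) p by blast
    then show ?thesis using line_in_comb[of 1 p 0 q "- D q g" t] False by simp
  next
    case True
    have e: "D g p \<noteq> 0" using reg True frame_regular[OF fr g h] by (simp add: t_def)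
    have d: "D q g \<noteq> 0" using frame_no_common_tangent[OF fr] True by (simp add: t_def)
    \<comment> \<open>This choice makes \<open>D g ?q\<close> vanish, the normal form of
      \<open>tangent_conic_line_in\<close>.\<close>
    let ?q = "(- D g q) *s p + (D g p) *s q"
    have "line_in p ?q"
      by (rule tangent_conic_line_in[of _ _ g])
         (use d e p True in \<open>simp_all add: cubic_simps t\<close>)
    then show ?thesis using line_in_comb[of 1 p 0 q "- D g q" "D g p"] e by simp
  qed
qed

text \<open>The plane \<open>p q g\<close> cuts out a t ((T p q g) b + (D g p) t) = 0, so the
  transversal \<open>q g\<close> lies on the surface. If \<open>g\<close> is not regular, this
  transversal and a second generated point \<open>y\<close> of \<open>g h\<close> fill the
  line.\<close>

lemma other_line_in_triangle:
  assumes fr: "frame p q g h" and pq: "line_in p q"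
    and g0: "D p g = 0" "D q g = 0" "D g q = 0" and gp: "D g p \<noteq> 0"
  shows "line_in g h"
proof -
  note [simp] = frame_simps[OF fr] g0
  define t where "t = T p q g"
  have t: "T p q g = t" "T p g q = t" "T q p g = t" "T q g p = t" "T g p q = t" "T g q p = t"
    by (simp_all add: t_def T_perms[where p=p and q=q and y=g])
  have "t \<noteq> 0" using frame_no_common_tangent[OF fr] by (simp add: t_def)
  have g: "g \<in> Sp" by (rule Sp_tangent_pt[OF line_in_ends(1)[OF pq]]) (simp_all add: gp)
  show ?thesis
  proof (cases "regular g")
    case True
    then show ?thesis using regular_line_in[OF frame_lines[OF fr] g] by simp
  next
    case irr: False
    \<comment> \<open>The vertex of the triangle opposite to \<open>p q\<close>; it lies on
      \<open>q g\<close>.\<close>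
    let ?y = "(D g p) *s q + (- t) *s g"
    have "bitangent p q ?y" "F ?y = 0"
      using \<open>t \<noteq> 0\<close> by (simp_all add: bitangent_def cubic_simps t power2_eq_square algebra_simps)
    then have "line_in q ?y" using bitangent_line_in(2) line_in_ends(1)[OF pq] by blast
    then have qg: "line_in q g" using line_in_comb[of 1 q 0 g "D g p" "-t"] \<open>t \<noteq> 0\<close> by simp
    define \<mu> \<omega> where "\<mu> = D p h" and "\<omega> = D q h"
    have \<mu>\<omega>: "\<mu> \<noteq> 0" "\<omega> \<noteq> 0"
      using frame_smooth[OF fr] frame_smooth[OF frame_swap[OF fr]] by (simp_all add: \<mu>_def \<omega>_def)
    define k where "k = - T p q h / t"
    define h' where "h' = h + k *s g"
    have h': "D p h' = \<mu>" "D q h' = \<omega>" "T p q h' = 0" "T q p h' = 0"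
      using \<open>t \<noteq> 0\<close>
      by (simp_all add: h'_def k_def \<mu>_def \<omega>_def cubic_simps t T_perms[where p=p and q=q and y=h])
    obtain \<beta> where \<beta>: "\<beta> \<noteq> 0" "\<omega> * \<beta>^2 \<noteq> \<mu>"
      using exists_nonzero_sq_neq[OF card4 \<mu>\<omega>(2)] .
    \<comment> \<open>As in \<open>bitangent_another\<close>, \<open>?Q\<close> and
      \<open>?Q'\<close> share a tangent plane; \<open>y\<close> is its intersection with
      \<open>g h\<close>.\<close>
    let ?Q = "p + \<beta> *s q" and ?Q' = "(\<omega> * \<beta>) *s p + \<mu> *s q"
    define y where "y = (- (\<mu> + \<omega> * \<beta>^2)) *s g + (\<beta> * t) *s h'"
    have y_eq: "y = (- (\<mu> + \<omega> * \<beta>^2) + \<beta> * t * k) *s g + (\<beta> * t) *s h"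
      by (simp add: y_def h'_def vec_eq_iff algebra_simps)
    have fy: "frame y g p q"
      unfolding y_eq
      using frame_comb[OF frame_lines[OF fr], of "- (\<mu> + \<omega> * \<beta>^2) + \<beta> * t * k" 0 "\<beta> * t" 1]
        \<beta>(1) \<open>t \<noteq> 0\<close> by simp
    have gy: "line_in g h" if "line_in y g"
      using that line_in_comb[of "- (\<mu> + \<omega> * \<beta>^2) + \<beta> * t * k" g "\<beta> * t" h 1 0]
        \<beta>(1) \<open>t \<noteq> 0\<close> by (simp add: y_eq)
    have Qy: "D ?Q y = 0" "D ?Q' y = 0" "D q y = \<beta> * t * \<omega>"
      by (simp_all add: y_def cubic_simps t h') (simp_all add: power2_eq_square algebra_simps)
    \<comment> \<open>Otherwise the derivative at \<open>y\<close> vanishes on all of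
      \<open>p q\<close>, against smoothness. Hence \<open>y\<close> is a tangency residue from
      \<open>?Q\<close> or \<open>?Q'\<close>.\<close>
    have "D y ?Q \<noteq> 0 \<or> D y ?Q' \<noteq> 0"
    proof (rule ccontr)
      assume "\<not> ?thesis"
      then have eqs: "D y p + \<beta> * D y q = 0" "\<omega> * \<beta> * D y p + \<mu> * D y q = 0"
        by (simp_all add: cubic_simps)
      have P: "D y p = - (\<beta> * D y q)" using eqs(1) by (simp add: eq_neg_iff_add_eq_0)
      have "(\<mu> - \<omega> * \<beta>^2) * D y q = \<omega> * \<beta> * D y p + \<mu> * D y q"
        unfolding P by (simp add: power2_eq_square algebra_simps)
      then have "(\<mu> - \<omega> * \<beta>^2) * D y q = 0" unfolding eqs(2) .
      then have "D y q = 0" using \<beta>(2) by simp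
      moreover from this have "D y p = 0" using P by simp
      ultimately show False using frame_smooth[OF fy] by simp
    qed
    moreover have "?Q \<in> Sp" "?Q' \<in> Sp"
      using line_inD[OF pq, of 1 \<beta>] line_inD[OF pq, of "\<omega> * \<beta>" \<mu>] \<mu>\<omega> by simp_all
    ultimately have y: "y \<in> Sp"
      using Sp_tangent_pt[OF _ Qy(1)] Sp_tangent_pt[OF _ Qy(2)] frame_simps(1)[OF fy] by blast
    show ?thesis
    proof (cases "D y q = 0")
      case True
      then have "regular y" using Qy(3) \<beta>(1) \<mu>\<omega> \<open>t \<noteq> 0\<close> by (intro regularI[of _ q]) simp_all
      then show ?thesis using regular_line_in[OF fy y] gy by blast
    next
      case False
      define m where "m = D q y"
      define n where "n = D y q"
      have mn: "m \<noteq> 0" "n \<noteq> 0" using Qy(3) \<beta>(1) \<mu>\<omega> \<open>t \<noteq> 0\<close> False by (simp_all add: m_def n_def)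
      note [simp] = frame_simps[OF fy]
      \<comment> \<open>As \<open>g\<close> is not regular, the plane \<open>q y g\<close> cuts out
        three lines through \<open>g\<close>: \<open>q g\<close>, \<open>y g\<close> and one
        containing \<open>?R\<close>. Secants joining \<open>?R\<close> to points \<open>?M\<close>
        of \<open>q g\<close> sweep out \<open>y g\<close>.\<close>
      have "T q y g = 0"
      proof (rule ccontr)
        assume "T q y g \<noteq> 0"
        then have "D g (q + y) = 0" "D (q + y) g \<noteq> 0" by (simp_all add: cubic_simps)
        then show False using irr regularI by blast
      qed
      then have T0: "T q y g = 0" "T q g y = 0" "T y q g = 0" "T y g q = 0" "T g q y = 0" "T g y q = 0"
        by (simp_all add: T_perms[where p=q and q=y and y=g])
      let ?R = "n *s q + (- m) *s y"
      have R: "?R \<in> Sp"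
        using Sp_third[OF line_in_ends(2)[OF pq] y] mn by (simp add: m_def n_def)
      have "line_in y g"
        unfolding line_in_def
      proof (intro allI impI)
        fix b a :: 'a assume "b \<noteq> 0 \<or> a \<noteq> 0"
        show "b *s y + a *s g \<in> Sp"
        proof (cases "b = 0")
          case True
          then show ?thesis using Sp_scale[OF g, of a] \<open>b \<noteq> 0 \<or> a \<noteq> 0\<close> by simp
        next
          case False
          let ?M = "(b * n) *s q + (m * a) *s g"
          have M: "?M \<in> Sp" using line_inD[OF qg] False mn by simp
          have DM: "D ?M ?R = - (n^2 * m^2 * b^2)" "D ?R ?M = - (n^2 * m^2 * b)"
            by (simp_all add: cubic_simps T0 m_def[symmetric] n_def[symmetric])
               (simp_all add: power2_eq_square mult_ac)
          have "D ?R ?M *s ?M + (- D ?M ?R) *s ?R \<in> Sp"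
            using Sp_third[OF M R] False mn unfolding DM by simp
          also have "D ?R ?M *s ?M + (- D ?M ?R) *s ?R = (- (n^2 * m^3 * b)) *s (b *s y + a *s g)"
            unfolding DM by (simp add: vec_eq_iff power2_eq_square power3_eq_cube algebra_simps)
          finally show ?thesis by (rule Sp_unscale)
        qed
      qed
      then show ?thesis by (rule gy)
    qed
  qed
qed

lemma other_line_in:
  assumes fr: "frame p q g h" and p: "p \<in> Sp" and reg: "regular p"
  shows "line_in g h"
proof -
  have pq: "line_in p q" using assms by (rule regular_line_in)
  obtain g' h' where fr: "frame p q g' h'" and g: "D p g' = 0" and h: "D p h' \<noteq> 0"
    and return: "line_in g' h' \<Longrightarrow> line_in g h"
    using fr by (rule frame_tangent) blast
  note [simp] = frame_simps[OF fr] g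
  have gp: "T p q g' \<noteq> 0 \<or> D g' p \<noteq> 0" using frame_regular[OF fr g h] reg by simp
  have "line_in g' h'"
  proof (cases "D g' p = 0")
    case False
    \<comment> \<open>Chosen so that \<open>D g' q'\<close> vanishes. Then either the triangle lemma
      applies, or \<open>q'\<close> witnesses that the generated point \<open>g'\<close> is
      regular.\<close>
    define q' where "q' = (- D g' q) *s p + D g' p *s q"
    have fr': "frame p q' g' h'"
      using frame_comb[OF fr, of 1 "D g' p" 0 "- D g' q"] False by (simp add: q'_def)
    have pq': "line_in p q'" using regular_line_in[OF fr' p reg] .
    have gq': "D g' q' = 0" by (simp add: q'_def cubic_simps)
    show ?thesis
    proof (cases "D q' g' = 0")
      case True
      show ?thesis by (rule other_line_in_triangle[OF fr' pq' g True gq' False])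
    next
      case ne: False
      have "g' \<in> Sp" using Sp_tangent_pt[OF p g] \<open>D g' p \<noteq> 0\<close> by simp
      then show ?thesis
        using regular_line_in[OF frame_lines[OF fr']] regularI[OF gq' ne] by blast
    qed
  next
    case True
    then have t: "T p q g' \<noteq> 0" using gp by simp
    \<comment> \<open>The second point of the line with the tangent plane of \<open>p\<close>; the
      triangle lemma applies with \<open>p\<close> and \<open>q'\<close> exchanged.\<close>
    define q' where "q' = (- D q g') *s p + T p q g' *s q"
    have fr': "frame p q' g' h'"
      using frame_comb[OF fr, of 1 "T p q g'" 0 "- D q g'"] t by (simp add: q'_def)
    have pq': "line_in p q'" using regular_line_in[OF fr' p reg] .
    have "D q' g' = 0"
      by (simp add: q'_def cubic_simps power2_eq_square T_perms[where p=p and q=q and y=g'])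
    moreover have "D g' q' \<noteq> 0" using frame_smooth[OF frame_lines[OF fr']] True by simp
    moreover have "line_in q' p" using pq' line_in_comb[of 0 q' 1 p 1 0] by simp
    ultimately show ?thesis
      using other_line_in_triangle[OF frame_swap[OF fr']] g True by blast
  qed
  then show ?thesis by (rule return)
qed

section \<open>From the two lines to the whole surface\<close>

text \<open>The plane \<open>p q g\<close> cuts out \<open>p q\<close>, \<open>p g\<close> and a
  third line, which contains \<open>?U\<close>. By the last hypothesis p + g is off the third line,
  so the line from \<open>?U\<close> through it meets \<open>p q\<close> in a generated point that
  determines it.\<close>

lemma transversal_point:
  assumes fr: "frame p q g h" and pq: "line_in p q" and g: "g \<in> Sp"
    and pg: "D p g = 0" "D g p = 0" and ne: "T p q g + D g q \<noteq> 0"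
  shows "p + g \<in> Sp"
proof -
  note [simp] = frame_simps[OF fr] pg
  define t where "t = T p q g"
  define n where "n = D g q"
  define d where "d = D q g"
  have t: "T p q g = t" "T p g q = t" "T q p g = t" "T q g p = t" "T g p q = t" "T g q p = t"
    by (simp_all add: t_def T_perms[where p=p and q=q and y=g])
  have n: "n \<noteq> 0" using frame_smooth[OF frame_lines[OF fr]] by (simp add: n_def)
  obtain \<alpha> where \<alpha>: "\<alpha> * t + d \<noteq> 0"
    using frame_no_common_tangent[OF fr] that[of 0] that[of 1] by (cases "d = 0") (auto simp: t_def d_def)
  define k where "k = \<alpha> * t + d"
  let ?x = "\<alpha> *s p + q"
  have x: "?x \<in> Sp" using line_inD[OF pq, of \<alpha> 1] by simp
  have Dx: "D ?x g = k" "D g ?x = n" by (simp_all add: cubic_simps t k_def n_def d_def)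
  let ?U = "n *s ?x + (- k) *s g"
  have U: "?U \<in> Sp" using Sp_third[OF x g] n by (simp add: Dx)
  have DU: "D ?U (p + g) = - (k * (n * (t + n)))" "D (p + g) ?U = n * (t + n)"
    by (simp_all add: cubic_simps t n_def[symmetric] d_def[symmetric])
       (simp_all add: k_def power2_eq_square algebra_simps)
  have "D (p + g) ?U *s ?U + (- D ?U (p + g)) *s (p + g)
      = (n * (t + n)) *s ((n * \<alpha> + k) *s p + n *s q)"
    unfolding DU by (simp add: vec_eq_iff algebra_simps)
  also have "\<dots> \<in> Sp"
    using Sp_scale[OF line_inD[OF pq, of "n * \<alpha> + k" n]] n ne by (simp add: t_def n_def)
  finally have "D (p + g) ?U *s ?U + (- D ?U (p + g)) *s (p + g) \<in> Sp" .
  moreover have "F (p + g) = 0" by (simp add: cubic_simps)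
  moreover have "D (p + g) ?U \<noteq> 0" unfolding DU using n ne by (simp add: t_def n_def)
  ultimately show ?thesis using Sp_second[OF U] by blast
qed

text \<open>If \<open>p g\<close> is not on the surface, p + g is its third point. Otherwise the
  tangent plane at p + g contains \<open>p\<close> and \<open>g\<close>, hence misses
  \<open>q\<close> or \<open>h\<close>, and the plane through the missed point serves.\<close>

lemma sum_point:
  assumes fr: "frame p q g h" and pq: "line_in p q" and gh: "line_in g h" and F: "F (p + g) = 0"
  shows "p + g \<in> Sp"
proof -
  note [simp] = frame_simps[OF fr]
  note p = line_in_ends(1)[OF pq] and g = line_in_ends(1)[OF gh]
  have sum: "D g p = - D p g" using F by (simp add: cubic_simps add_eq_0_iff)
  show ?thesis
  proof (cases "D p g = 0")
    case False
    then have "(- D p g) *s p + (- D p g) *s g \<in> Sp" using Sp_third[OF p g] sum by simp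
    also have "(- D p g) *s p + (- D p g) *s g = (- D p g) *s (p + g)"
      by (simp add: vec_eq_iff algebra_simps)
    finally show ?thesis by (rule Sp_unscale)
  next
    case True
    then have 0 [simp]: "D p g = 0" "D g p = 0" using sum by simp_all
    have "T p q g + D g q \<noteq> 0 \<or> T g h p + D p h \<noteq> 0"
    proof (rule ccontr)
      assume neg: "\<not> ?thesis"
      have "p + g \<noteq> 0" using basis4D(1)[OF frame_basis[OF fr], of 1 0 1 0] by auto
      then obtain w where w: "D (p + g) w \<noteq> 0" using F by (rule smooth_pt)
      obtain a b d e where "w = a *s p + b *s q + d *s g + e *s h"
        using frame_basis[OF fr] by (rule basis4E)
      moreover have "D (p + g) p = 0" "D (p + g) g = 0" "D (p + g) q = 0" "D (p + g) h = 0"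
        using neg
        by (simp_all add: cubic_simps T_perms[where p=p and q=q and y=g] T_perms[where p=g and q=h and y=p] add.commute)
      ultimately show False using w by (simp add: cubic_D_add_right cubic_D_scale_right)
    qed
    then show ?thesis
      using transversal_point[OF fr pq g] transversal_point[OF frame_lines[OF fr] gh p]
      by (auto simp: add.commute)
  qed
qed

lemma frame_extend:
  assumes fr: "frame p q g h" and pq: "line_in p q" and ab: "a \<noteq> 0 \<or> b \<noteq> 0"
  obtains q' where "frame (a *s p + b *s q) q' g h" "line_in (a *s p + b *s q) q'"
proof -
  obtain a' b' where det: "a * b' - b * a' \<noteq> 0"
    using ab by (rule complete_det)
  have "line_in (a *s p + b *s q) (a' *s p + b' *s q)"
  \<comment> \<open>The adjugate matrix turns the new basis back into a multiple of the old
    one.\<close>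
  proof (rule line_in_comb[where a = b' and b = "- b" and a' = "- a'" and b' = a])
    show "b' * a - - b * - a' \<noteq> 0" using det by (simp add: mult.commute)
    have "b' *s (a *s p + b *s q) + (- b) *s (a' *s p + b' *s q) = (a * b' - b * a') *s p"
      "(- a') *s (a *s p + b *s q) + a *s (a' *s p + b' *s q) = (a * b' - b * a') *s q"
      by (simp_all add: vec_eq_iff algebra_simps)
    moreover have "line_in (k *s p) (k *s q)" if "k \<noteq> 0" for k
      unfolding line_in_def
    proof (intro allI impI)
      fix x y :: 'a assume "x \<noteq> 0 \<or> y \<noteq> 0"
      then have "(x * k) *s p + (y * k) *s q \<in> Sp" using that by (intro line_inD[OF pq]) simp
      then show "x *s (k *s p) + y *s (k *s q) \<in> Sp" by (simp add: vector_smult_assoc)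
    qed
    ultimately show "line_in (b' *s (a *s p + b *s q) + (- b) *s (a' *s p + b' *s q))
        ((- a') *s (a *s p + b *s q) + a *s (a' *s p + b' *s q))"
      using det by simp
  qed
  then show thesis using that frame_comb[OF fr det] by blast
qed

lemma all_points:
  assumes fr: "frame p q g h" and pq: "line_in p q" and gh: "line_in g h"
    and u: "u \<noteq> 0" "F u = 0"
  shows "u \<in> Sp"
proof -
  obtain a b d e where u_eq: "u = a *s p + b *s q + d *s g + e *s h"
    using frame_basis[OF fr] by (rule basis4E)
  consider "a = 0 \<and> b = 0" | "d = 0 \<and> e = 0" | "a \<noteq> 0 \<or> b \<noteq> 0" "d \<noteq> 0 \<or> e \<noteq> 0" by blast
  then show ?thesis
  proof cases
    case 1
    then show ?thesis using u line_inD[OF gh, of d e] by (cases "d = 0 \<and> e = 0") (auto simp: u_eq)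
  next
    case 2
    then show ?thesis using u line_inD[OF pq, of a b] by (cases "a = 0 \<and> b = 0") (auto simp: u_eq)
  next
    \<comment> \<open>Off both lines, \<open>u\<close> is the sum of nonzero vectors from the two
      lines, which span the transversal through it.\<close>
    case 3
    obtain q' where fr1: "frame (a *s p + b *s q) q' g h" and l1: "line_in (a *s p + b *s q) q'"
      using fr pq 3(1) by (rule frame_extend)
    obtain h' where fr2: "frame (d *s g + e *s h) h' (a *s p + b *s q) q'"
      and l2: "line_in (d *s g + e *s h) h'"
      using frame_lines[OF fr1] gh 3(2) by (rule frame_extend)
    show ?thesis
      using sum_point[OF frame_lines[OF fr2] l1 l2] u(2) by (simp add: u_eq add.assoc)
  qed
qed

lemma regular_point_generates:
  assumes fr: "frame p q g h" and p: "p \<in> Sp" and reg: "regular p" and u: "u \<noteq> 0" "F u = 0"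
  shows "u \<in> Sp"
  using all_points[OF fr regular_line_in[OF fr p reg] other_line_in[OF fr p reg] u] .

end

section \<open>Eckardt points\<close>

lemma proj_pt_scale:
  assumes "a \<noteq> 0" shows "proj_pt (a *s x) = proj_pt x"
proof (intro equalityI subsetI)
  fix z assume "z \<in> proj_pt x"
  then obtain b where "b \<noteq> 0" "z = b *s x" by (auto simp: proj_pt_def)
  then have "b / a \<noteq> 0 \<and> z = (b / a) *s (a *s x)" using assms by (simp add: vector_smult_assoc)
  then show "z \<in> proj_pt (a *s x)" unfolding proj_pt_def by blast
next
  fix z assume "z \<in> proj_pt (a *s x)"
  then obtain b where "b \<noteq> 0" "z = b *s (a *s x)" by (auto simp: proj_pt_def)
  then have "b * a \<noteq> 0 \<and> z = (b * a) *s x" using assms by (simp add: vector_smult_assoc)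
  then show "z \<in> proj_pt x" unfolding proj_pt_def by blast
qed

lemma proj_pt_eqD:
  assumes "proj_pt x = proj_pt y" obtains a where "a \<noteq> 0" "x = a *s y"
proof -
  have "1 *s x \<in> proj_pt x" unfolding proj_pt_def using one_neq_zero by blast
  then show thesis using assms that by (auto simp: proj_pt_def)
qed

lemma surf_pts_eval: "proj_pt x \<in> surf_pts c \<Longrightarrow> cubic_eval c x = 0"
  by (auto simp: surf_pts_def cubic_F_scale elim: proj_pt_eqD)

lemma line_throughE:
  assumes "proj_pt x \<in> line_through u v" obtains a b where "x = a *s u + b *s v"
proof -
  obtain a b where "proj_pt x = proj_pt (a *s u + b *s v)" using assms by (auto simp: line_through_def)
  then obtain k where "x = k *s (a *s u + b *s v)" by (rule proj_pt_eqD)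
  then show thesis using that[of "k * a" "k * b"] by (simp add: vector_add_ldistrib vector_smult_assoc)
qed

lemma line_throughI: "a \<noteq> 0 \<or> b \<noteq> 0 \<Longrightarrow> proj_pt (a *s u + b *s v) \<in> line_through u v"
  by (auto simp: line_through_def)

lemma line_through_ends: "proj_pt u \<in> line_through u v" "proj_pt v \<in> line_through u v"
  using line_throughI[of 1 0 u v] line_throughI[of 0 1 u v] by simp_all

lemma line_on_surfI:
  assumes ind: "lin_indep2 (to_ac_vec u) (to_ac_vec v)"
    and "cubic_eval c u = 0" "cubic_eval c v = 0" "cubic_D c u v = 0" "cubic_D c v u = 0"
  shows "line_on_surf c (line_through (to_ac_vec u) (to_ac_vec v))"
  unfolding line_on_surf_def
proof
  show "line_through (to_ac_vec u) (to_ac_vec v) \<subseteq> surf_pts (to_ac \<circ> c)"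
  proof
    fix z assume "z \<in> line_through (to_ac_vec u) (to_ac_vec v)"
    then obtain a b where z: "z = proj_pt (a *s to_ac_vec u + b *s to_ac_vec v)"
      and ab: "a \<noteq> 0 \<or> b \<noteq> 0"
      by (auto simp: line_through_def)
    have "a *s to_ac_vec u + b *s to_ac_vec v \<noteq> 0" using ind ab by (auto simp: lin_indep2_def)
    moreover have "cubic_eval (to_ac \<circ> c) (a *s to_ac_vec u + b *s to_ac_vec v) = 0"
      using assms by (simp add: cubic_simps)
    ultimately show "z \<in> surf_pts (to_ac \<circ> c)" by (auto simp: surf_pts_def z)
  qed
qed (use ind in \<open>auto simp: is_line_def\<close>)

text \<open>The tangent plane section at \<open>p\<close> is b t ((D q g) b + (D g q) t), three
  lines through \<open>p\<close>. Smoothness makes both coefficients nonzero, so they are distinct;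
  \<open>r\<close> spans the third.\<close>

lemma (in secant_closed) eckardt_if_not_regular:
  assumes fr: "frame p q g h" and irr: "\<not> regular p"
  shows "eckardt c (proj_pt (to_ac_vec p))"
proof -
  obtain g h where fr: "frame p q g h" and g: "D p g = 0" and h: "D p h \<noteq> 0"
    using fr by (rule frame_tangent)
  have 0: "T p q g = 0" "D g p = 0" using irr frame_regular[OF fr g h] by simp_all
  note [simp] = frame_simps[OF fr] g 0
  define d where "d = D q g"
  define n where "n = D g q"
  have d: "d \<noteq> 0" using frame_no_common_tangent[OF fr] by (simp add: d_def)
  have n: "n \<noteq> 0" using frame_smooth[OF frame_lines[OF fr]] by (simp add: n_def)
  define r where "r = n *s q + (- d) *s g"
  have r: "F r = 0" "D p r = 0" "D r p = 0"
    by (simp_all add: r_def cubic_simps T_perms[where p=p and q=q and y=g] d_def[symmetric] n_def[symmetric])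
       (simp add: power2_eq_square)
  let ?v = to_ac_vec and ?L = "\<lambda>u v. line_through (to_ac_vec u) (to_ac_vec v)"
  note ind = basis4D[OF basis4_to_ac[OF frame_basis[OF fr]]]
  have r_ac: "a *s ?v p + b *s ?v r = a *s ?v p + (b * to_ac n) *s ?v q + (- (b * to_ac d)) *s ?v g + 0 *s ?v h" for a b
    by (simp add: r_def vec_eq_iff to_ac_vec_def algebra_simps)
  have "lin_indep2 (?v p) (?v q)" "lin_indep2 (?v p) (?v g)"
    unfolding lin_indep2_def using ind(1,2)[of _ _ 0 0] ind(1,3)[of _ 0 _ 0] by auto
  moreover have "lin_indep2 (?v p) (?v r)"
    unfolding lin_indep2_def
  proof (intro allI impI)
    fix a b assume "a *s ?v p + b *s ?v r = 0"
    then have "a = 0" "b * to_ac n = 0" unfolding r_ac using ind(1,2) by blast+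
    then show "a = 0 \<and> b = 0" using n by simp
  qed
  ultimately have on: "line_on_surf c (?L p q)" "line_on_surf c (?L p g)" "line_on_surf c (?L p r)"
    using r by (auto intro!: line_on_surfI)
  have "proj_pt (?v q) \<notin> ?L p g"
  proof
    assume "proj_pt (?v q) \<in> ?L p g"
    then obtain a b where "?v q = a *s ?v p + b *s ?v g" by (rule line_throughE)
    then have "a *s ?v p + (- 1) *s ?v q + b *s ?v g + 0 *s ?v h = 0" by simp
    then show False using ind(2) by fastforce
  qed
  moreover have "proj_pt (?v q) \<notin> ?L p r"
  proof
    assume "proj_pt (?v q) \<in> ?L p r"
    then obtain a b where "?v q = a *s ?v p + b *s ?v r" by (rule line_throughE)
    then have "a *s ?v p + (b * to_ac n - 1) *s ?v q + (- (b * to_ac d)) *s ?v g + 0 *s ?v h = 0"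
      unfolding r_ac by (simp add: vec_eq_iff algebra_simps)
    then have "b * to_ac n - 1 = 0" "- (b * to_ac d) = 0" using ind(2,3) by blast+
    then show False using d by simp
  qed
  moreover have "proj_pt (?v g) \<notin> ?L p r"
  proof
    assume "proj_pt (?v g) \<in> ?L p r"
    then obtain a b where "?v g = a *s ?v p + b *s ?v r" by (rule line_throughE)
    then have "a *s ?v p + (b * to_ac n) *s ?v q + (- (b * to_ac d) - 1) *s ?v g + 0 *s ?v h = 0"
      unfolding r_ac by (simp add: vec_eq_iff algebra_simps)
    then have "b * to_ac n = 0" "- (b * to_ac d) - 1 = 0" using ind(2,3) by blast+
    then show False using n by simp
  qed
  ultimately have "?L p q \<noteq> ?L p g" "?L p q \<noteq> ?L p r" "?L p g \<noteq> ?L p r"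
    using line_through_ends by metis+
  moreover have "proj_pt (?v p) \<in> surf_pts (to_ac \<circ> c)"
    using on(1) line_through_ends(1) unfolding line_on_surf_def by blast
  ultimately show ?thesis
    unfolding eckardt_def using on line_through_ends(1) by blast
qed

section \<open>The secant and tangent process\<close>

lemma span_step_mono: "B \<subseteq> span_step c B"
  by (auto simp: span_step_def)

lemma span_step_funpow_mono: "m \<le> n \<Longrightarrow> (span_step c ^^ m) B \<subseteq> (span_step c ^^ n) B"
  by (induction n) (use span_step_mono in \<open>auto simp: le_Suc_eq\<close>)

lemma Span_superset: "B \<subseteq> Span c B"
  unfolding Span_def using UN_upper[of 0 UNIV "\<lambda>n. (span_step c ^^ n) B"] by simp

lemma Span_subset_surf:
  assumes "B \<subseteq> surf_pts c" shows "Span c B \<subseteq> surf_pts c"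
proof -
  have "(span_step c ^^ n) B \<subseteq> surf_pts c" for n
    by (induction n) (use assms in \<open>auto simp: span_step_def\<close>)
  then show ?thesis by (auto simp: Span_def)
qed

text \<open>The stages increase, so both points occur in a common one.\<close>

lemma Span_closed:
  assumes "P \<in> Span c B" "Q \<in> Span c B" "R \<in> surf_pts c" "sec_tan c P Q R"
  shows "R \<in> Span c B"
proof -
  obtain m n where "P \<in> (span_step c ^^ m) B" "Q \<in> (span_step c ^^ n) B"
    using assms by (auto simp: Span_def)
  then have "P \<in> (span_step c ^^ max m n) B" "Q \<in> (span_step c ^^ max m n) B"
    using span_step_funpow_mono[of m "max m n" c B] span_step_funpow_mono[of n "max m n" c B] by auto
  then have "R \<in> (span_step c ^^ Suc (max m n)) B"
    using assms(3,4) by (auto simp: span_step_def)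
  then show ?thesis unfolding Span_def by blast
qed

lemma lin_indep2_if_not_in_surf:
  assumes "u \<noteq> 0" "cubic_eval c u = 0" "cubic_D c u v \<noteq> 0 \<or> cubic_D c v u \<noteq> 0 \<or> cubic_eval c v \<noteq> 0"
  shows "lin_indep2 u v"
  unfolding lin_indep2_def
proof (intro allI impI)
  fix a b assume 0: "a *s u + b *s v = 0"
  have "b = 0"
  proof (rule ccontr)
    assume "b \<noteq> 0"
    have "b *s v = (- a) *s u" using 0 by (simp add: add_eq_0_iff)
    then have "(1 / b) *s (b *s v) = (- a / b) *s u" by (simp add: vector_smult_assoc)
    then have "v = (- a / b) *s u" using \<open>b \<noteq> 0\<close> by (simp add: vector_smult_assoc)
    then show False using assms(2,3) by (simp add: cubic_simps)
  qed
  then show "a = 0 \<and> b = 0" using 0 assms(1) by simp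
qed

lemma sec_tanI:
  assumes "lin_indep2 u v" "k \<noteq> 0" "a1 \<noteq> 0 \<or> b1 \<noteq> 0" "a2 \<noteq> 0 \<or> b2 \<noteq> 0" "a3 \<noteq> 0 \<or> b3 \<noteq> 0"
    and "line_poly c u v = smult k ([:b1, -a1:] * [:b2, -a2:] * [:b3, -a3:])"
  shows "sec_tan c (proj_pt (a1 *s u + b1 *s v)) (proj_pt (a2 *s u + b2 *s v))
    (proj_pt (a3 *s u + b3 *s v))"
  unfolding sec_tan_def using assms by blast

text \<open>On this line the form is s t ((D u v) s + (D v u) t), and \<open>w\<close> is the
  remaining zero. The second order of the points recovers \<open>v\<close> from \<open>u\<close> and
  \<open>w\<close>.\<close>

lemma sec_tan_third:
  assumes "u \<noteq> 0" "cubic_eval c u = 0" "cubic_eval c v = 0"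
    and ne: "cubic_D c u v \<noteq> 0 \<or> cubic_D c v u \<noteq> 0"
  defines "w \<equiv> cubic_D c v u *s u + (- cubic_D c u v) *s v"
  shows "w \<noteq> 0" "cubic_eval c w = 0"
    and "sec_tan c (proj_pt u) (proj_pt v) (proj_pt w)" "sec_tan c (proj_pt u) (proj_pt w) (proj_pt v)"
proof -
  have ind: "lin_indep2 u v" using lin_indep2_if_not_in_surf assms by blast
  then show "w \<noteq> 0" using ne unfolding lin_indep2_def w_def by (metis neg_equal_0_iff_equal)
  show "cubic_eval c w = 0"
    using assms by (simp add: w_def cubic_simps power2_eq_square algebra_simps)
  show "sec_tan c (proj_pt u) (proj_pt v) (proj_pt w)"
    using sec_tanI[OF ind, of 1 1 0 0 1 "cubic_D c v u" "- cubic_D c u v" c] assms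
    by (cases "cubic_D c v u = 0") (simp_all add: line_poly_eq)
  show "sec_tan c (proj_pt u) (proj_pt w) (proj_pt v)"
    using sec_tanI[OF ind, of 1 1 0 "cubic_D c v u" "- cubic_D c u v" 0 1 c] assms
    by (cases "cubic_D c v u = 0") (simp_all add: line_poly_eq)
qed

lemma sec_tan_tangent:
  assumes "u \<noteq> 0" "cubic_eval c u = 0" "cubic_D c u v = 0"
    and ne: "cubic_D c v u \<noteq> 0 \<or> cubic_eval c v \<noteq> 0"
  defines "w \<equiv> cubic_eval c v *s u + (- cubic_D c v u) *s v"
  shows "w \<noteq> 0" "cubic_eval c w = 0" "sec_tan c (proj_pt u) (proj_pt u) (proj_pt w)"
proof -
  have ind: "lin_indep2 u v" using lin_indep2_if_not_in_surf assms by blast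
  then show "w \<noteq> 0" using ne unfolding lin_indep2_def w_def by (metis neg_equal_0_iff_equal)
  show "cubic_eval c w = 0"
    using assms by (simp add: w_def cubic_simps power2_eq_square power3_eq_cube algebra_simps)
  show "sec_tan c (proj_pt u) (proj_pt u) (proj_pt w)"
    \<comment> \<open>The factor -1 cancels the sign of the linear form belonging to
      \<open>w\<close>.\<close>
    using sec_tanI[OF ind, of "-1" 1 0 1 0 "cubic_eval c v" "- cubic_D c v u" c] assms
    by (cases "cubic_D c v u = 0") (simp_all add: line_poly_eq)
qed

lemma secant_closed_Span:
  fixes c :: "(4 \<Rightarrow> nat) \<Rightarrow> 'a::field"
  assumes "infinite (UNIV :: 'a set) \<or> card (UNIV :: 'a set) \<ge> 4" "smooth_cubic c"
    and B: "B \<subseteq> surf_pts c"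
  shows "secant_closed c {x. x \<noteq> 0 \<and> proj_pt x \<in> Span c B}"
proof -
  have eval: "cubic_eval c x = 0" if "proj_pt x \<in> Span c B" for x
    using Span_subset_surf[OF B] that surf_pts_eval by blast
  have pt: "proj_pt x \<in> surf_pts c" if "x \<noteq> 0" "cubic_eval c x = 0" for x
    using that by (auto simp: surf_pts_def)
  show ?thesis
  proof (unfold_locales, goal_cases)
    case (3 u)
    then show ?case by simp
  next
    case (4 u)
    then show ?case using eval by simp
  next
    case (5 u a)
    then show ?case by (simp add: proj_pt_scale)
  next
    case (6 u v)
    then have u: "u \<noteq> 0" "cubic_eval c u = 0" "cubic_eval c v = 0" using eval by auto
    note * = sec_tan_third[OF u 6(3)]
    show ?case using Span_closed[OF _ _ pt[OF *(1,2)] *(3)] *(1) 6 by simp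
  next
    case (7 u v)
    then have u: "u \<noteq> 0" "cubic_eval c u = 0" using eval by auto
    note * = sec_tan_third[OF u 7(2,3)]
    have v: "v \<noteq> 0" using 7(3) cubic_D_scale_right[of c u 0 v] cubic_D_scale_left[of c 0 v u] by auto
    show ?case using Span_closed[OF _ _ pt[OF v 7(2)] *(4)] v 7 by simp
  next
    case (8 u v)
    then have u: "u \<noteq> 0" "cubic_eval c u = 0" using eval by auto
    note * = sec_tan_tangent[OF u 8(2,3)]
    show ?case using Span_closed[OF _ _ pt[OF *(1,2)] *(3)] *(1) 8 by simp
  qed (use assms in auto)
qed

section \<open>From the geometric hypotheses to coordinates\<close>

lemma line_on_surf_eval:
  fixes c :: "(4 \<Rightarrow> nat) \<Rightarrow> 'a::field"
  assumes card4: "infinite (UNIV :: 'a set) \<or> card (UNIV :: 'a set) \<ge> 4"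
    and on: "line_on_surf c (line_through (to_ac_vec u) (to_ac_vec v))"
  shows "cubic_eval c u = 0" "cubic_eval c v = 0" "cubic_D c u v = 0" "cubic_D c v u = 0"
proof -
  have eval: "cubic_eval c (a *s u + b *s v) = 0" if ab: "a \<noteq> 0 \<or> b \<noteq> 0" for a b
  proof -
    have "proj_pt (to_ac a *s to_ac_vec u + to_ac b *s to_ac_vec v) \<in> surf_pts (to_ac \<circ> c)"
      using on line_throughI[of "to_ac a" "to_ac b" "to_ac_vec u" "to_ac_vec v"] ab
      by (auto simp: line_on_surf_def)
    then have "cubic_eval (to_ac \<circ> c) (to_ac_vec (a *s u + b *s v)) = 0"
      using surf_pts_eval by simp
    then show ?thesis by (simp only: cubic_to_ac to_ac_eq_0_iff)
  qed
  show uv: "cubic_eval c u = 0" "cubic_eval c v = 0" using eval[of 1 0] eval[of 0 1] by simp_all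
  \<comment> \<open>With \<open>x\<close> other than 0 and 1, the vanishing at u + v and u + x v
    forces both middle coefficients to be zero.\<close>
  obtain x :: 'a where x: "x \<noteq> 0" "1 * x^2 \<noteq> 1"
    using exists_nonzero_sq_neq[OF card4, of 1 1] by auto
  have 1: "cubic_D c u v = - cubic_D c v u"
    using eval[of 1 1] uv by (simp add: cubic_simps eq_neg_iff_add_eq_0)
  have "x * (cubic_D c u v + x * cubic_D c v u) = 0"
    using eval[of 1 x] uv by (simp add: cubic_simps power2_eq_square algebra_simps)
  then have "(x - 1) * cubic_D c v u = 0" using x(1) unfolding 1 by (simp add: algebra_simps)
  then show "cubic_D c v u = 0" using x(2) by auto
  then show "cubic_D c u v = 0" using 1 by simp
qed

lemma skew_basis4:
  assumes ind: "lin_indep2 u v" "lin_indep2 u' v'"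
    and skew: "line_through (to_ac_vec u) (to_ac_vec v) \<inter> line_through (to_ac_vec u') (to_ac_vec v') = {}"
  shows "basis4 u v u' v'"
  unfolding basis4_iff_indep
proof (intro allI impI)
  fix a b d e assume 0: "a *s u + b *s v + d *s u' + e *s v' = 0"
  then have eq: "a *s u + b *s v = (- d) *s u' + (- e) *s v'"
    by (simp add: vec_eq_iff algebra_simps eq_neg_iff_add_eq_0)
  show "a = 0 \<and> b = 0 \<and> d = 0 \<and> e = 0"
  proof (cases "a = 0 \<and> b = 0")
    case True
    then show ?thesis using 0 ind(2) by (auto simp: lin_indep2_def)
  next
    case ab: False
    have de: "d \<noteq> 0 \<or> e \<noteq> 0"
      using eq ab ind(1) by (auto simp: lin_indep2_def)
    have "proj_pt (to_ac_vec (a *s u + b *s v)) \<in> line_through (to_ac_vec u) (to_ac_vec v)"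
      unfolding to_ac_vec_add to_ac_vec_scale using ab by (intro line_throughI) simp
    moreover have "proj_pt (to_ac_vec ((- d) *s u' + (- e) *s v'))
        \<in> line_through (to_ac_vec u') (to_ac_vec v')"
      unfolding to_ac_vec_add to_ac_vec_scale using de by (intro line_throughI) simp
    ultimately show ?thesis using skew unfolding eq by blast
  qed
qed

text \<open>The point is known to lie on the line only over the closure; uniqueness of coordinates
  there kills its rational coordinates at \<open>g\<close> and \<open>h\<close>.\<close>

lemma (in secant_closed) nonEckardt_generates:
  assumes fr: "frame u v g h" and p: "p \<in> Sp"
    and on: "proj_pt (to_ac_vec p) \<in> line_through (to_ac_vec u) (to_ac_vec v)"
    and ne: "\<not> eckardt c (proj_pt (to_ac_vec p))" and x: "x \<noteq> 0" "F x = 0"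
  shows "x \<in> Sp"
proof -
  obtain s t where st: "to_ac_vec p = s *s to_ac_vec u + t *s to_ac_vec v"
    using on by (rule line_throughE)
  obtain a b d e where p_eq: "p = a *s u + b *s v + d *s g + e *s h"
    using frame_basis[OF fr] by (rule basis4E)
  have "(to_ac a - s) *s to_ac_vec u + (to_ac b - t) *s to_ac_vec v
      + to_ac d *s to_ac_vec g + to_ac e *s to_ac_vec h = 0"
    using st by (simp add: p_eq vec_eq_iff algebra_simps)
  note de = basis4D(3,4)[OF basis4_to_ac[OF frame_basis[OF fr]] this]
  then have p_eq: "p = a *s u + b *s v" by (simp add: p_eq)
  have "a \<noteq> 0 \<or> b \<noteq> 0" using Sp_nonzero[OF p] by (auto simp: p_eq)
  then obtain a' b' where "a * b' - b * a' \<noteq> 0" by (rule complete_det)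
  then have "frame p (a' *s u + b' *s v) g h" using frame_comb[OF fr] by (simp add: p_eq)
  then show ?thesis using regular_point_generates p eckardt_if_not_regular ne x by blast
qed

theorem theorem1:
  fixes c :: "(4 \<Rightarrow> nat) \<Rightarrow> 'a::field"
    and L L' :: "('a alg_closure ^4) set set"
    and p :: "'a ^4"
  assumes card4: "infinite (UNIV :: 'a set) \<or> card (UNIV :: 'a set) \<ge> 4"
    and smooth: "smooth_cubic c"
    and L_on: "line_on_surf c L" and L'_on: "line_on_surf c L'"
    and L_K: "K_line L" and L'_K: "K_line L'"
    and skew: "L \<inter> L' = {}"
    and p_nz: "p \<noteq> 0"
    and p_S: "proj_pt p \<in> surf_pts c"
    and p_on: "proj_pt (to_ac_vec p) \<in> L \<or> proj_pt (to_ac_vec p) \<in> L'"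
    and not_eck: "\<not> eckardt c (proj_pt (to_ac_vec p))"
  shows "Span c {proj_pt p} = surf_pts c"
proof
  let ?Sp = "{x. x \<noteq> 0 \<and> proj_pt x \<in> Span c {proj_pt p}}"
  have B: "{proj_pt p} \<subseteq> surf_pts c" using p_S by simp
  then show "Span c {proj_pt p} \<subseteq> surf_pts c" by (rule Span_subset_surf)
  interpret secant_closed c ?Sp
    using card4 smooth B by (rule secant_closed_Span)
  obtain u v where uv: "lin_indep2 u v" and L: "L = line_through (to_ac_vec u) (to_ac_vec v)"
    using L_K by (auto simp: K_line_def)
  obtain g h where gh: "lin_indep2 g h" and L': "L' = line_through (to_ac_vec g) (to_ac_vec h)"
    using L'_K by (auto simp: K_line_def)
  have fr: "frame u v g h"
    unfolding frame_def
    using skew_basis4[OF uv gh] skew line_on_surf_eval[OF card4] L_on L'_on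
    unfolding L L' by blast
  have p: "p \<in> ?Sp" using p_nz Span_superset[of "{proj_pt p}" c] by simp
  show "surf_pts c \<subseteq> Span c {proj_pt p}"
  proof
    fix P assume "P \<in> surf_pts c"
    then obtain x where P: "P = proj_pt x" and x: "x \<noteq> 0" "cubic_eval c x = 0"
      by (auto simp: surf_pts_def)
    have "x \<in> ?Sp"
      using p_on nonEckardt_generates[OF fr p _ not_eck x]
        nonEckardt_generates[OF frame_lines[OF fr] p _ not_eck x]
      unfolding L L' by blast
    then show "P \<in> Span c {proj_pt p}" by (simp add: P)
  qed
qed

end
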